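(* Let $k\geq 2$ and $n\geq k+1$ be integers. For a tuple $(s_1,\dots,s_k)$ of positive integers write $S_i=s_1+\cdots+s_i$ for $i=1,\dots,k-1$. Then $$ \sum_{\substack{s_i\geq 1,\ s_1\geq 2\\ s_1+\cdots+s_{k}=n}} \Big[2^{s_1-1}+(2^{s_1-1}-1)\Big(\sum_{i=2}^{k-1} 2^{S_i-s_1-(i-1)}+ 2^{S_{k-1}-s_1-(k-2)}\Big)\Big]\, \zeta(s_1,\dots, s_{k})=n\,\zeta(n), $$ where the inner sum $\sum_{i=2}^{k-1}$ is empty (zero) when $k=2$.
   Context: For integers $s_1\geq 2$ and $s_2,\dots,s_k\geq 1$, the multiple zeta value is $\zeta(s_1,\dots,s_k)=\sum_{n_1>n_2>\cdots>n_k\geq 1} \frac{1}{n_1^{s_1}\cdots n_k^{s_k}}$; for $k=1$ this is the Riemann zeta value $\zeta(n)$. *)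

theory Defs
  imports "HOL-Analysis.Analysis"
begin

definition mzv :: "nat list \<Rightarrow> real" where
  "mzv s = infsum (\<lambda>ns. \<Prod>i<length s. 1 / real (ns ! i) ^ (s ! i))
     {ns. length ns = length s \<and> sorted_wrt (>) ns \<and> (\<forall>m\<in>set ns. m \<ge> 1)}"

definition psum :: "nat list \<Rightarrow> nat \<Rightarrow> nat" where
  "psum s i = sum_list (take i s)"

definition coef :: "nat list \<Rightarrow> real" where
  "coef s = (let k = length s; s1 = s ! 0 in
     2 ^ (s1 - 1) + (2 ^ (s1 - 1) - 1) *
       ((\<Sum>i=2..k-1. 2 ^ (psum s i - s1 - (i - 1))) + 2 ^ (psum s (k-1) - s1 - (k - 2))))"

end

theory Submission
  imports Defs "HOL-Complex_Analysis.Cauchy_Integral_Formula"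
begin

text \<open>
  For fixed depth \<open>k\<close> we compare generating functions in the weight, at a real point \<open>0 < x < 1/2\<close>,
  so that every series has nonnegative terms and summations may be exchanged freely. Summing over
  all exponents turns \<open>1 / n_i ^ s_i\<close> into \<open>1 / (n_i - x)\<close>, and an exponent weighted by a power of 2
  into \<open>1 / (n_i - 2 x)\<close>. Write \<open>e_j(N)\<close> for the sum of \<open>1 / ((n_1 - x) ... (n_j - x))\<close> over
  \<open>N > n_1 > ... > n_j > 0\<close>.

  The weights of the theorem are those of the shuffle product of \<open>\<zeta>(r)\<close> with depth \<open>k - 1\<close> values:
  apart from the unweighted sum, the generating function of the left-hand side is the sum over
  \<open>a, b > 0\<close> of \<open>x e_{k-2}(b) / ((a + b - x) (a - x) (b - x))\<close>. Summing over \<open>a\<close> by partial fractions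
  leaves the sum over \<open>b\<close> of \<open>x e_{k-2}(b) e_1(b + 1) / (b (b - x))\<close>, and
  \<open>e_1 e_j = (j + 1) e_{j+1} + e_j'\<close> reduces it to the sum formula
  \<open>\<Sum>b. e_j(b) / (b (b - x)) = \<Sum>m. 1 / (m ^ (j+1) (m - x))\<close> for \<open>j = k - 1\<close> and to its derivative
  in \<open>x\<close> for \<open>j = k - 2\<close>.

  The sum formula follows by the connected sum method of Seki and Yamamoto, with connector
  \<open>\<Gamma>(m+1-x) \<Gamma>(n+1-x) / (\<Gamma>(1-x) \<Gamma>(m+n+1-x))\<close>.
\<close>

section \<open>Exchange of summation for nonnegative families\<close>

lemma nonneg_has_sum_SigmaI:
  fixes f :: "'a \<Rightarrow> 'b \<Rightarrow> real"
  assumes "\<And>a b. a \<in> A \<Longrightarrow> b \<in> B a \<Longrightarrow> 0 \<le> f a b"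
    and "\<And>a. a \<in> A \<Longrightarrow> (f a has_sum g a) (B a)"
    and "(g has_sum S) A"
  shows "((\<lambda>(a, b). f a b) has_sum S) (Sigma A B)"
proof (rule has_sum_SigmaI)
  show "(\<lambda>(a, b). f a b) summable_on Sigma A B"
    by (rule summable_on_SigmaI[where g = g]) (use assms in \<open>auto intro: has_sum_imp_summable\<close>)
qed (use assms in auto)

text \<open>Tonelli: nonnegativity makes the double family summable as soon as one iterated sum
  exists. Summability in the other order is a conclusion, and this is how convergence of the zeta
  values and of the sums of Taylor coefficients is obtained later.\<close>

lemma nonneg_has_sum_swap_ex:
  fixes f :: "'a \<Rightarrow> 'b \<Rightarrow> real"
  assumes "\<And>a b. a \<in> A \<Longrightarrow> b \<in> B \<Longrightarrow> 0 \<le> f a b"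
    and "\<And>a. a \<in> A \<Longrightarrow> (f a has_sum g a) B"
    and "(g has_sum S) A"
  shows "b \<in> B \<Longrightarrow> (\<lambda>a. f a b) summable_on A"
    and "((\<lambda>b. \<Sum>\<^sub>\<infinity>a\<in>A. f a b) has_sum S) B"
proof -
  have 1: "((\<lambda>(b, a). f a b) has_sum S) (B \<times> A)"
    using nonneg_has_sum_SigmaI[of A "\<lambda>_. B" f g S] assms
    by (subst has_sum_swap) (simp add: case_prod_unfold)
  show 2: "(\<lambda>a. f a b) summable_on A" if "b \<in> B" for b
    using summable_on_SigmaD1[OF has_sum_imp_summable[OF 1] that] by simp
  show "((\<lambda>b. \<Sum>\<^sub>\<infinity>a\<in>A. f a b) has_sum S) B"
    by (rule has_sum_SigmaD[OF 1]) (use 2 in auto)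
qed

lemma nonneg_has_sum_swap:
  fixes f :: "'a \<Rightarrow> 'b \<Rightarrow> real"
  assumes "\<And>a b. a \<in> A \<Longrightarrow> b \<in> B \<Longrightarrow> 0 \<le> f a b"
    and "\<And>a. a \<in> A \<Longrightarrow> (f a has_sum g a) B"
    and "(g has_sum S) A"
    and "\<And>b. b \<in> B \<Longrightarrow> ((\<lambda>a. f a b) has_sum h b) A"
  shows "(h has_sum S) B"
proof -
  have "((\<lambda>b. \<Sum>\<^sub>\<infinity>a\<in>A. f a b) has_sum S) B"
    using assms by (intro nonneg_has_sum_swap_ex(2)[where g = g]) auto
  moreover have "(\<Sum>\<^sub>\<infinity>a\<in>A. f a b) = h b" if "b \<in> B" for b
    using assms(4)[OF that] by (rule infsumI)
  ultimately show ?thesis by (simp cong: has_sum_cong)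
qed

lemma has_sum_sum_fun:
  fixes f :: "'i \<Rightarrow> 'a \<Rightarrow> real"
  assumes "finite I" "\<And>i. i \<in> I \<Longrightarrow> (f i has_sum g i) A"
  shows "((\<lambda>a. \<Sum>i\<in>I. f i a) has_sum (\<Sum>i\<in>I. g i)) A"
  using assms by (induction I rule: finite_induct) (auto intro!: has_sum_add)

lemma has_sum_from_1_iff:
  "(f has_sum S) {1::nat..} \<longleftrightarrow> ((\<lambda>n. f (Suc n)) has_sum S) UNIV"
  by (rule has_sum_reindex_bij_witness[of _ Suc "\<lambda>n. n - 1"]) auto

lemma has_sum_nonneg_mult_product:
  fixes f :: "'a \<Rightarrow> real" and g :: "'b \<Rightarrow> real"
  assumes "(f has_sum S) A" "(g has_sum T) B"
    and "\<And>a. a \<in> A \<Longrightarrow> 0 \<le> f a" "\<And>b. b \<in> B \<Longrightarrow> 0 \<le> g b"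
  shows "((\<lambda>(a, b). f a * g b) has_sum S * T) (A \<times> B)"
  by (rule nonneg_has_sum_SigmaI[where g = "\<lambda>a. f a * T"])
     (use assms in \<open>auto intro!: has_sum_cmult_right has_sum_cmult_left\<close>)

section \<open>Geometric series in a single exponent\<close>

lemma has_sum_geometric_shifted:
  fixes y :: real
  assumes "0 \<le> y" "y < real m"
  shows "((\<lambda>a. y ^ (a - 1) / real m ^ a) has_sum 1 / (real m - y)) {1..}"
proof -
  have m: "real m > 0" using assms by linarith
  have "(\<lambda>n. (y / real m) ^ n) sums (1 / (1 - y / real m))"
    using assms m by (intro geometric_sums) auto
  from sums_mult[OF this, of "1 / real m"]
  have "(\<lambda>n. y ^ n / real m ^ Suc n) sums (1 / (real m - y))"
    using m assms by (simp add: field_simps power_divide)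
  then have "((\<lambda>n. y ^ n / real m ^ Suc n) has_sum (1 / (real m - y))) UNIV"
    by (rule sums_nonneg_imp_has_sum) (use assms in auto)
  then show ?thesis by (subst has_sum_from_1_iff) simp
qed

lemma has_sum_geometric_shifted_from_2:
  fixes y :: real
  assumes "0 \<le> y" "y < real m"
  shows "((\<lambda>a. y ^ (a - 1) / real m ^ a) has_sum y / (real m * (real m - y))) {2..}"
proof -
  have m: "real m > 0" using assms by linarith
  have "((\<lambda>a. y / real m * (y ^ (a - 1) / real m ^ a)) has_sum y / real m * (1 / (real m - y))) {1..}"
    by (intro has_sum_cmult_right has_sum_geometric_shifted assms)
  also have "?this \<longleftrightarrow> ((\<lambda>a. y ^ (a - 1) / real m ^ a) has_sum y / (real m * (real m - y))) {2..}"
  proof (rule has_sum_reindex_bij_witness[of _ "\<lambda>n. n - 1" Suc])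
    fix a assume "a \<in> {1::nat..}"
    then show "y ^ (Suc a - 1) / real m ^ Suc a = y / real m * (y ^ (a - 1) / real m ^ a)"
      by (cases a) auto
  qed auto
  finally show ?thesis .
qed

section \<open>Power series with nonnegative coefficients\<close>

text \<open>The difference of the two series vanishes on an interval accumulating at 0, whereas a
  power series with a nonzero coefficient has no zeros in some punctured neighbourhood of 0.\<close>

lemma powser_coeff_unique:
  fixes a b :: "nat \<Rightarrow> real"
  assumes "0 < r"
    and "\<And>x. 0 < x \<Longrightarrow> x < r \<Longrightarrow> ((\<lambda>p. a p * x ^ p) has_sum F x) {1..}"
    and "\<And>x. 0 < x \<Longrightarrow> x < r \<Longrightarrow> ((\<lambda>p. b p * x ^ p) has_sum F x) {1..}"
    and "1 \<le> p"
  shows "a p = b p"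
proof (rule ccontr)
  assume neq: "a p \<noteq> b p"
  \<comment> \<open>Both series start at index 1, so coefficient 0 is filled in as 0; this also
    gives \<open>f 0 = 0\<close>, which the isolated-zero argument requires.\<close>
  define c where "c = (\<lambda>n. if n = 0 then 0 else a n - b n)"
  have z: "(\<lambda>n. c n * x ^ n) sums 0" if "0 < x" "x < r" for x
  proof -
    have "((\<lambda>n. a n * x ^ n + - (b n * x ^ n)) has_sum F x + - F x) {1..}"
      by (intro has_sum_add has_sum_uminusI assms that)
    also have "?this \<longleftrightarrow> ((\<lambda>n. c n * x ^ n) has_sum 0) UNIV"
      unfolding add.right_inverse
      by (rule has_sum_cong_neutral) (auto simp: c_def algebra_simps not_le)
    finally show ?thesis by (rule has_sum_imp_sums)
  qed
  define f where "f = (\<lambda>x. \<Sum>n. c n * x ^ n)"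
  \<comment> \<open>Convergence is known only at positive points; a positive \<open>y\<close>
    between \<open>norm x\<close> and \<open>r\<close> carries it over to \<open>x\<close> of either
    sign.\<close>
  have sm: "(\<lambda>n. c n * (x - 0) ^ n) sums f x" if "norm (x - 0) < r" for x :: real
  proof -
    obtain y where y: "norm x < y" "y < r" using \<open>norm (x - 0) < r\<close> dense by auto
    then have "0 < y" using norm_ge_zero[of x] by linarith
    have "summable (\<lambda>n. c n * y ^ n)"
      using z[OF \<open>0 < y\<close> \<open>y < r\<close>] by (rule sums_summable)
    then have "summable (\<lambda>n. c n * x ^ n)"
      by (rule powser_inside) (use y \<open>0 < y\<close> in auto)
    then show ?thesis by (simp add: f_def summable_sums)
  qed
  have "f 0 = 0" unfolding f_def powser_zero by (simp add: c_def)
  moreover have "c p \<noteq> 0" using neq \<open>1 \<le> p\<close> by (simp add: c_def)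
  ultimately obtain s where s: "0 < s" "\<And>z. z \<in> cball 0 s - {0} \<Longrightarrow> f z \<noteq> 0"
    using powser_0_nonzero[OF \<open>0 < r\<close> sm, of p] \<open>1 \<le> p\<close> by auto
  define t where "t = min s (r / 2)"
  have "0 < t" "t < r" "t \<le> s" using \<open>0 < r\<close> \<open>0 < s\<close> by (auto simp: t_def)
  have "f t = 0" using z[OF \<open>0 < t\<close> \<open>t < r\<close>] by (simp add: f_def sums_iff)
  moreover have "f t \<noteq> 0" using s(2)[of t] \<open>0 < t\<close> \<open>t \<le> s\<close> by auto
  ultimately show False by simp
qed

text \<open>The class contains the factors \<open>1 / (m - x)\<close> with \<open>m \<ge> 1\<close>,
  whose poles lie at 1 or beyond, and is closed under sums and products. It therefore covers every
  summand that is differentiated in \<open>x\<close>.\<close>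

definition nonneg_powser :: "(real \<Rightarrow> real) \<Rightarrow> bool" where
  "nonneg_powser f \<longleftrightarrow>
     (\<exists>c. (\<forall>n. 0 \<le> c n) \<and> (\<forall>x. 0 < x \<longrightarrow> x < 1 \<longrightarrow> ((\<lambda>n. c n * x ^ n) has_sum f x) UNIV))"

lemma nonneg_powser_const: "0 \<le> a \<Longrightarrow> nonneg_powser (\<lambda>_. a)"
  unfolding nonneg_powser_def
  by (rule exI[of _ "\<lambda>n. if n = 0 then a else 0"])
     (auto intro!: has_sum_finite_neutralI[where B = "{0}"] split: if_splits)

lemma nonneg_powser_add:
  assumes "nonneg_powser f" "nonneg_powser g"
  shows "nonneg_powser (\<lambda>x. f x + g x)"
proof -
  obtain c d where "\<And>n. 0 \<le> c n" "\<And>n. 0 \<le> d n"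
    and "\<And>x. 0 < x \<Longrightarrow> x < 1 \<Longrightarrow> ((\<lambda>n. c n * x ^ n) has_sum f x) UNIV"
    and "\<And>x. 0 < x \<Longrightarrow> x < 1 \<Longrightarrow> ((\<lambda>n. d n * x ^ n) has_sum g x) UNIV"
    using assms unfolding nonneg_powser_def by metis
  then show ?thesis unfolding nonneg_powser_def
    by (intro exI[of _ "\<lambda>n. c n + d n"]) (auto intro!: has_sum_add simp: distrib_right)
qed

lemma nonneg_powser_sum:
  assumes "finite I" "\<And>i. i \<in> I \<Longrightarrow> nonneg_powser (f i)"
  shows "nonneg_powser (\<lambda>x. \<Sum>i\<in>I. f i x)"
  using assms
  by (induction I rule: finite_induct) (auto intro: nonneg_powser_const nonneg_powser_add)

text \<open>Cauchy products of nonnegative coefficients are nonnegative, and nonnegativity supplies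
  the absolute convergence that the product requires.\<close>

lemma nonneg_powser_mult:
  assumes "nonneg_powser f" "nonneg_powser g"
  shows "nonneg_powser (\<lambda>x. f x * g x)"
proof -
  obtain c d where c: "\<And>n. 0 \<le> c n" and d: "\<And>n. 0 \<le> d n"
    and f: "\<And>x. 0 < x \<Longrightarrow> x < 1 \<Longrightarrow> ((\<lambda>n. c n * x ^ n) has_sum f x) UNIV"
    and g: "\<And>x. 0 < x \<Longrightarrow> x < 1 \<Longrightarrow> ((\<lambda>n. d n * x ^ n) has_sum g x) UNIV"
    using assms unfolding nonneg_powser_def by metis
  define e where "e = (\<lambda>n. \<Sum>i\<le>n. c i * d (n - i))"
  have nn: "0 \<le> e n" for n unfolding e_def using c d by (intro sum_nonneg) auto
  have "((\<lambda>n. e n * x ^ n) has_sum f x * g x) UNIV" if x: "0 < x" "x < 1" for x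
  proof (rule sums_nonneg_imp_has_sum)
    have ss: "(\<lambda>n. c n * x ^ n) sums f x" "(\<lambda>n. d n * x ^ n) sums g x"
      by (intro has_sum_imp_sums f g x)+
    then have sm: "summable (\<lambda>n. norm (c n * x ^ n))" "summable (\<lambda>n. norm (d n * x ^ n))"
      using c d x by (auto simp: sums_iff)
    have "(\<lambda>k. \<Sum>i\<le>k. (c i * x ^ i) * (d (k - i) * x ^ (k - i))) sums
        ((\<Sum>k. c k * x ^ k) * (\<Sum>k. d k * x ^ k))"
      by (rule Cauchy_product_sums[OF sm])
    moreover have "(\<Sum>i\<le>k. (c i * x ^ i) * (d (k - i) * x ^ (k - i))) = e k * x ^ k" for k
    proof -
      have "(c i * x ^ i) * (d (k - i) * x ^ (k - i)) = c i * d (k - i) * x ^ k" if "i \<le> k" for i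
        using that by (simp add: mult_ac flip: power_add)
      then show ?thesis unfolding e_def sum_distrib_right by (intro sum.cong) auto
    qed
    ultimately show "(\<lambda>n. e n * x ^ n) sums (f x * g x)"
      using ss by (simp add: sums_iff)
  qed (use nn x in auto)
  then show ?thesis unfolding nonneg_powser_def using nn by blast
qed

lemma nonneg_powser_shifted_inverse:
  assumes "1 \<le> m"
  shows "nonneg_powser (\<lambda>x. 1 / (real m - x))"
  unfolding nonneg_powser_def
proof (intro exI[of _ "\<lambda>n. 1 / real m ^ Suc n"] conjI allI impI)
  fix x :: real assume "0 < x" "x < 1"
  then have "((\<lambda>a. x ^ (a - 1) / real m ^ a) has_sum 1 / (real m - x)) {1..}"
    using assms by (intro has_sum_geometric_shifted) auto
  then show "((\<lambda>n. 1 / real m ^ Suc n * x ^ n) has_sum 1 / (real m - x)) UNIV"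
    by (subst (asm) has_sum_from_1_iff) simp
qed simp

text \<open>The coefficients \<open>(n + 1) * c (n + 1)\<close> of the derivative are again
  nonnegative, so the classical termwise derivative, a statement about \<open>sums\<close>, becomes
  one about \<open>has_sum\<close>.\<close>

lemma nonneg_powser_deriv:
  fixes f :: "real \<Rightarrow> real"
  assumes f: "\<And>x. 0 < x \<Longrightarrow> x < 1 \<Longrightarrow> ((\<lambda>n. c n * x ^ n) has_sum f x) UNIV"
    and c: "\<And>n. 0 \<le> c n"
    and x: "0 < x" "x < 1"
  shows "((\<lambda>n. diffs c n * x ^ n) has_sum deriv f x) UNIV"
proof -
  have sm: "summable (\<lambda>n. c n * z ^ n)" if z: "norm z < 1" for z :: real
  proof -
    obtain y where y: "norm z < y" "y < 1" using z dense by blast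
    then have "0 < y" using norm_ge_zero[of z] by linarith
    have "summable (\<lambda>n. c n * y ^ n)"
      using f[OF \<open>0 < y\<close> \<open>y < 1\<close>] by (intro summable_on_imp_summable has_sum_imp_summable)
    then show ?thesis by (rule powser_inside) (use y \<open>0 < y\<close> in auto)
  qed
  have "((\<lambda>z. \<Sum>n. c n * z ^ n) has_field_derivative (\<Sum>n. diffs c n * x ^ n)) (at x)"
    by (rule termdiffs_strong'[OF sm]) (use x in auto)
  then have D: "(f has_field_derivative (\<Sum>n. diffs c n * x ^ n)) (at x)"
  proof (rule has_field_derivative_transform_within_open[where S = "{0<..<1}"])
    show "(\<Sum>n. c n * z ^ n) = f z" if "z \<in> {0<..<1}" for z
      using has_sum_imp_sums[OF f[of z]] that by (auto simp: sums_iff)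
  qed (use x in auto)
  have "summable (\<lambda>n. diffs c n * x ^ n)"
    by (rule termdiff_converges[OF _ sm]) (use x in auto)
  then have "(\<lambda>n. diffs c n * x ^ n) sums deriv f x"
    using DERIV_imp_deriv[OF D] by (simp add: sums_iff)
  then show ?thesis
    by (rule sums_nonneg_imp_has_sum) (use c x in \<open>auto simp: diffs_def\<close>)
qed

text \<open>Termwise differentiation of a series of functions needs no uniformity when all the
  functions have nonnegative Taylor coefficients: the coefficients of the sum are then obtained by
  exchanging two nonnegative summations, and the same exchange applies after differentiation.\<close>

lemma has_sum_deriv_nonneg_powser:
  assumes "\<And>i. i \<in> A \<Longrightarrow> nonneg_powser (f i)"
    and F: "\<And>x. 0 < x \<Longrightarrow> x < 1 \<Longrightarrow> ((\<lambda>i. f i x) has_sum F x) A"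
    and x: "0 < x" "x < 1"
  shows "((\<lambda>i. deriv (f i) x) has_sum deriv F x) A"
proof -
  obtain c where c: "\<And>i n. i \<in> A \<Longrightarrow> 0 \<le> c i n"
    and f: "\<And>i x. i \<in> A \<Longrightarrow> 0 < x \<Longrightarrow> x < 1 \<Longrightarrow> ((\<lambda>n. c i n * x ^ n) has_sum f i x) UNIV"
    using assms(1) unfolding nonneg_powser_def by metis
  define C where "C = (\<lambda>n. \<Sum>\<^sub>\<infinity>i\<in>A. c i n)"
  have "(\<lambda>i. c i n * (1/2) ^ n) summable_on A" for n
    by (rule nonneg_has_sum_swap_ex(1)[of A UNIV "\<lambda>i n. c i n * (1/2)^n" "\<lambda>i. f i (1/2)" "F (1/2)"])
       (use c f F in auto)
  then have "(\<lambda>i. c i n) summable_on A" for n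
    by (simp add: summable_on_cmult_left')
  then have C: "((\<lambda>i. c i n) has_sum C n) A" for n
    by (simp add: C_def)
  have C0: "0 \<le> C n" for n unfolding C_def using c by (intro infsum_nonneg) auto
  have CF: "((\<lambda>n. C n * z ^ n) has_sum F z) UNIV" if "0 < z" "z < 1" for z
    by (rule nonneg_has_sum_swap[of A UNIV "\<lambda>i n. c i n * z^n" "\<lambda>i. f i z" "F z"])
       (use c f F C that in \<open>auto intro: has_sum_cmult_left\<close>)
  have dF: "((\<lambda>n. diffs C n * x ^ n) has_sum deriv F x) UNIV"
    by (rule nonneg_powser_deriv[OF CF C0 x])
  show ?thesis
  proof (rule nonneg_has_sum_swap[of UNIV A "\<lambda>n i. diffs (c i) n * x ^ n"])
    show "((\<lambda>n. diffs C n * x ^ n) has_sum deriv F x) UNIV" by (rule dF)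
    show "((\<lambda>i. diffs (c i) n * x ^ n) has_sum diffs C n * x ^ n) A" for n
      unfolding diffs_def by (intro has_sum_cmult_left has_sum_cmult_right C)
    show "((\<lambda>n. diffs (c i) n * x ^ n) has_sum deriv (f i) x) UNIV" if "i \<in> A" for i
      by (rule nonneg_powser_deriv[OF f c x]) (use that in auto)
  qed (use c x in \<open>auto simp: diffs_def\<close>)
qed

section \<open>The sum formula\<close>

text \<open>The head of the list belongs to the largest variable, which stays strictly below
  \<open>N\<close>. This is the generating function of truncated multiple zeta values with one
  parameter per exponent; equal parameters give the e_j(N) of the overview.\<close>

fun shifted_sum :: "real list \<Rightarrow> nat \<Rightarrow> real" where
  "shifted_sum [] N = 1"
| "shifted_sum (y # ys) N = (\<Sum>m\<in>{1..<N}. shifted_sum ys m / (real m - y))"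

abbreviation esum :: "nat \<Rightarrow> real \<Rightarrow> nat \<Rightarrow> real" where
  "esum j x \<equiv> shifted_sum (replicate j x)"

lemma shifted_sum_nonneg:
  assumes "\<And>y. y \<in> set ys \<Longrightarrow> y < 1"
  shows "0 \<le> shifted_sum ys N"
  using assms
proof (induction ys arbitrary: N)
  case (Cons y ys)
  have "0 \<le> shifted_sum ys m / (real m - y)" if "m \<in> {1..<N}" for m
  proof -
    have "y < 1" using Cons.prems by simp
    moreover have "1 \<le> real m" using that by simp
    ultimately have "0 \<le> real m - y" by linarith
    then show ?thesis using Cons by simp
  qed
  then have "0 \<le> (\<Sum>m\<in>{1..<N}. shifted_sum ys m / (real m - y))"
    by (intro sum_nonneg)
  then show ?case by simp
qed simp

lemma esum_nonneg: "x < 1 \<Longrightarrow> 0 \<le> esum j x N"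
  by (rule shifted_sum_nonneg) simp

section \<open>The connector and the transport of exponents\<close>

definition shifted_fact :: "real \<Rightarrow> nat \<Rightarrow> real" where
  "shifted_fact x n = (\<Prod>i\<in>{1..n}. real i - x)"

text \<open>Since \<open>shifted_fact x n\<close> equals Gamma(n+1-x) / Gamma(1-x), this is the
  Gamma quotient of the overview, written with finite products only.\<close>

definition connector :: "real \<Rightarrow> nat \<Rightarrow> nat \<Rightarrow> real" where
  "connector x m n = shifted_fact x m * shifted_fact x n / shifted_fact x (m + n)"

lemma shifted_fact_pos: "x < 1 \<Longrightarrow> 0 < shifted_fact x n"
  unfolding shifted_fact_def by (intro prod_pos) auto

lemma connector_pos: "x < 1 \<Longrightarrow> 0 < connector x m n"
  by (simp add: connector_def shifted_fact_pos)

lemma connector_commute: "connector x m n = connector x n m"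
  by (simp add: connector_def add.commute mult.commute)

lemma connector_0: "x < 1 \<Longrightarrow> connector x m 0 = 1"
  using shifted_fact_pos[of x m] by (simp add: connector_def) (simp add: shifted_fact_def)

lemma connector_Suc:
  assumes "x < 1"
  shows "connector x (Suc m) n = connector x m n * (real (Suc m) - x) / (real (Suc m + n) - x)"
proof -
  have "shifted_fact x (Suc k) = shifted_fact x k * (real (Suc k) - x)" for k
    by (simp add: shifted_fact_def)
  then show ?thesis by (simp add: connector_def)
qed

text \<open>The property for which the connector is chosen: a factor \<open>1 / n\<close> on one
  side is traded for \<open>1 / (m + 1 - x)\<close> on the other, at the price of a difference in
  \<open>m\<close> that telescopes.\<close>

lemma connector_diff:
  assumes "x < 1" "1 \<le> n"
  shows "(connector x m n - connector x (Suc m) n) / real n = connector x (Suc m) n / (real (Suc m) - x)"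
proof -
  have a: "real (Suc m) - x > 0" "real (Suc m + n) - x > 0" using assms by auto
  have e: "connector x m n = connector x (Suc m) n * (real (Suc m + n) - x) / (real (Suc m) - x)"
    using a by (simp add: connector_Suc[OF assms(1)])
  have "connector x m n - connector x (Suc m) n = connector x (Suc m) n * real n / (real (Suc m) - x)"
    unfolding e using a(1) by (simp add: field_simps)
  then show ?thesis using assms by simp
qed

text \<open>At \<open>n = 1\<close> the connector is \<open>(1 - x) / (m + 1 - x)\<close>, and each
  further step in \<open>n\<close> multiplies it by a factor of at most 1. The decay in
  \<open>m\<close> removes the boundary term at infinity from the telescoping sum.\<close>

lemma connector_le:
  assumes "0 < x" "x < 1" "1 \<le> n"
  shows "connector x m n \<le> 1 / real (Suc m)"
  using assms(3)
proof (induction n rule: dec_induct)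
  case base
  have "connector x m 1 = (1 - x) / (real (Suc m) - x)"
    using connector_Suc[of x 0 m] connector_0[of x m] assms
    by (simp add: connector_commute)
  also have "\<dots> \<le> 1 / real (Suc m)"
    using assms by (simp add: field_simps)
  finally show ?case .
next
  case (step n)
  have "connector x m (Suc n) = connector x m n * ((real (Suc n) - x) / (real (Suc n + m) - x))"
    using connector_Suc[of x n m] assms by (simp add: connector_commute)
  also have "\<dots> \<le> connector x m n * 1"
    using assms connector_pos[of x m n] by (intro mult_left_mono) auto
  finally show ?case using step by simp
qed

lemma connector_tendsto_0:
  assumes "0 < x" "x < 1" "1 \<le> n"
  shows "(\<lambda>m. connector x m n) \<longlonglongrightarrow> 0"
proof (rule tendsto_sandwich[OF _ _ tendsto_const])
  show "(\<lambda>m. 1 / real (Suc m)) \<longlonglongrightarrow> 0" using LIMSEQ_Suc[OF lim_1_over_n] by simp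
qed (use assms connector_le connector_pos[of x, THEN less_imp_le] in auto)

lemma connector_has_sum:
  assumes "0 < x" "x < 1" "1 \<le> n"
  shows "((\<lambda>m. connector x m n / (real m - x)) has_sum connector x a n / real n) {a<..}"
proof -
  have nn: "0 \<le> connector x (Suc k) n / (real (Suc k) - x)" for k
    using assms connector_pos[of x "Suc k" n] by auto
  have "(\<lambda>k. connector x (k + a) n) \<longlonglongrightarrow> 0"
    by (rule LIMSEQ_ignore_initial_segment[OF connector_tendsto_0[OF assms]])
  from sums_divide[OF telescope_sums'[OF this], of "real n"]
  have "(\<lambda>k. connector x (Suc (k + a)) n / (real (Suc (k + a)) - x)) sums (connector x a n / real n)"
    using connector_diff[OF assms(2,3)] by simp
  then have "((\<lambda>k. connector x (Suc (k + a)) n / (real (Suc (k + a)) - x)) has_sum (connector x a n / real n)) UNIV"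
    using nn by (rule sums_nonneg_imp_has_sum)
  also have "?this \<longleftrightarrow> ?thesis"
    by (rule has_sum_reindex_bij_witness[of _ "\<lambda>n. n - Suc a" "\<lambda>k. Suc (k + a)"]) auto
  finally show ?thesis .
qed

text \<open>The side of the connected sum that has a single variable \<open>m\<close>, joined by the
  connector to the neighbour \<open>b\<close> on the other side. At \<open>b = 0\<close> the
  connector is 1 and the plain series of the sum formula remains.\<close>

definition connected_sum :: "real \<Rightarrow> nat \<Rightarrow> nat \<Rightarrow> real" where
  "connected_sum x j b = (\<Sum>\<^sub>\<infinity>m\<in>{1..}. connector x m b / (real m ^ j * (real m - x)))"

text \<open>From \<open>m - x \<ge> (1 - x) * m\<close> for \<open>m \<ge> 1\<close>, the terms are
  dominated by those of the series of inverse squares divided by \<open>1 - x\<close>.\<close>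

lemma summable_on_power_shifted:
  assumes "0 < x" "x < 1" "1 \<le> j"
  shows "(\<lambda>m. 1 / (real m ^ j * (real m - x))) summable_on {1::nat..}"
proof -
  have 1: "summable (\<lambda>n. 1 / (1 - x) * (1 / real (Suc n) ^ 2))"
    using inverse_power_summable[of 2, where 'a = real]
    by (intro summable_mult) (subst summable_Suc_iff, simp add: inverse_eq_divide)
  have 2: "1 / (real (Suc n) ^ j * (real (Suc n) - x)) \<le> 1 / (1 - x) * (1 / real (Suc n) ^ 2)" for n
  proof -
    have p: "real (Suc n) \<le> real (Suc n) ^ j"
      using assms(3) power_increasing[of 1 j "real (Suc n)"] by simp
    have "real (Suc n) - x - (1 - x) * real (Suc n) = x * real n" by (simp add: algebra_simps)
    then have q: "(1 - x) * real (Suc n) \<le> real (Suc n) - x"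
      using assms by (smt (verit) mult_nonneg_nonneg of_nat_0_le_iff)
    have "(1 - x) * real (Suc n) ^ 2 = real (Suc n) * ((1 - x) * real (Suc n))"
      by (simp add: power2_eq_square)
    also have "\<dots> \<le> real (Suc n) ^ j * (real (Suc n) - x)"
      using p q assms by (intro mult_mono) auto
    finally have "(1 - x) * real (Suc n) ^ 2 \<le> real (Suc n) ^ j * (real (Suc n) - x)" .
    moreover have "0 < (1 - x) * real (Suc n) ^ 2" using assms by simp
    ultimately show ?thesis by (simp add: frac_le del: of_nat_Suc)
  qed
  have "summable (\<lambda>n. 1 / (real (Suc n) ^ j * (real (Suc n) - x)))"
    by (rule summable_comparison_test'[OF 1, of 0]) (use 2 assms in auto)
  then have "(\<lambda>n. 1 / (real (Suc n) ^ j * (real (Suc n) - x))) summable_on UNIV"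
    by (rule summable_nonneg_imp_summable_on) (use assms in auto)
  then show ?thesis
    unfolding summable_on_def has_sum_from_1_iff .
qed

lemma connector_le_1:
  assumes "0 < x" "x < 1"
  shows "connector x m n \<le> 1"
proof (cases "n = 0")
  case False
  then have "connector x m n \<le> 1 / real (Suc m)" using assms by (intro connector_le) auto
  also have "\<dots> \<le> 1" by simp
  finally show ?thesis .
qed (use assms in \<open>simp add: connector_0\<close>)

lemma connected_sum_has_sum:
  assumes "0 < x" "x < 1" "1 \<le> j"
  shows "((\<lambda>m. connector x m b / (real m ^ j * (real m - x))) has_sum connected_sum x j b) {1..}"
  unfolding connected_sum_def
proof (rule has_sum_infsum, rule summable_on_comparison_test[OF summable_on_power_shifted[OF assms]])
  fix m :: nat assume m: "m \<in> {1..}"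
  then have "0 < real m - x" using assms by auto
  then have "0 < real m ^ j * (real m - x)" using m by simp
  then show "connector x m b / (real m ^ j * (real m - x)) \<le> 1 / (real m ^ j * (real m - x))"
    using connector_le_1[OF assms(1,2)] by (intro divide_right_mono) auto
  show "0 \<le> connector x m b / (real m ^ j * (real m - x))"
    using connector_pos[OF assms(2), of m b] \<open>0 < real m ^ j * (real m - x)\<close> by simp
qed

text \<open>For exponent 0 the comparison with inverse squares fails; convergence comes from the
  decay of the connector, by telescoping, and this needs \<open>b \<ge> 1\<close>.\<close>

lemma connected_sum_0_left:
  assumes "0 < x" "x < 1" "1 \<le> b"
  shows "((\<lambda>m. connector x m b / (real m ^ 0 * (real m - x))) has_sum 1 / real b) {1..}"
  using connector_has_sum[OF assms, of 0] assms connector_0[of x b]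
  by (simp add: connector_commute atLeast_Suc_greaterThan)

lemma connected_sum_0:
  assumes "0 < x" "x < 1" "1 \<le> b"
  shows "connected_sum x 0 b = 1 / real b"
  unfolding connected_sum_def by (rule infsumI[OF connected_sum_0_left[OF assms]])

lemma connected_sum_nonneg:
  assumes "x < 1"
  shows "0 \<le> connected_sum x j b"
  unfolding connected_sum_def
  using assms connector_pos[OF assms, THEN less_imp_le] by (intro infsum_nonneg) auto

text \<open>The transport relation: one unit of the exponent of the single variable m is traded for a new
  summation variable.\<close>

lemma connected_sum_transport:
  assumes x: "0 < x" "x < 1"
  shows "((\<lambda>n. connected_sum x j n / (real n - x)) has_sum connected_sum x (Suc j) b) {b<..}"
proof (rule nonneg_has_sum_swap[of "{1..}" "{b<..}"
      "\<lambda>m n. 1 / (real m ^ j * (real m - x)) * (connector x m n / (real n - x))"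
      "\<lambda>m. connector x m b / (real m ^ Suc j * (real m - x))"])
  show "((\<lambda>m. connector x m b / (real m ^ Suc j * (real m - x))) has_sum connected_sum x (Suc j) b) {1..}"
    using x by (intro connected_sum_has_sum) auto
next
  fix m :: nat assume m: "m \<in> {1..}"
  have "((\<lambda>n. connector x m n / (real n - x)) has_sum connector x m b / real m) {b<..}"
    using connector_has_sum[OF x, of m b] m by (simp add: connector_commute)
  from has_sum_cmult_right[OF this, of "1 / (real m ^ j * (real m - x))"]
  show "((\<lambda>n. 1 / (real m ^ j * (real m - x)) * (connector x m n / (real n - x))) has_sum
      connector x m b / (real m ^ Suc j * (real m - x))) {b<..}"
    by (simp add: mult_ac)
next
  fix n assume n: "n \<in> {b<..}"
  have "((\<lambda>m. connector x m n / (real m ^ j * (real m - x))) has_sum connected_sum x j n) {1..}"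
  proof (cases j)
    case 0
    then show ?thesis
      using connected_sum_0_left[OF x, of n] connected_sum_0[OF x, of n] n by simp
  next
    case (Suc i)
    then show ?thesis using connected_sum_has_sum[OF x, of j n] by simp
  qed
  from has_sum_cmult_left[OF this, of "1 / (real n - x)"]
  show "((\<lambda>m. 1 / (real m ^ j * (real m - x)) * (connector x m n / (real n - x))) has_sum
       connected_sum x j n / (real n - x)) {1..}" by (simp add: mult_ac)
next
  fix m n assume "m \<in> {1::nat..}" "n \<in> {b<..}"
  then have "0 < real m - x" "0 < real n - x" using x by auto
  then show "0 \<le> 1 / (real m ^ j * (real m - x)) * (connector x m n / (real n - x))"
    using connector_pos[OF x(2), of m n] by simp
qed

text \<open>Each use of the transport relation absorbs the largest variable of the chain and raises
  the exponent of \<open>m\<close> by one, so the induction on \<open>i\<close> runs with arbitrary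
  \<open>j\<close>. The last variable is absorbed at the bound 0.\<close>

lemma esum_connected_has_sum:
  assumes x: "0 < x" "x < 1"
  shows "((\<lambda>n. esum i x n / (real n - x) * connected_sum x j n) has_sum
           connected_sum x (Suc (i + j)) 0) {1..}"
proof (induction i arbitrary: j)
  case 0
  show ?case using connected_sum_transport[OF x, of j 0]
    by (simp add: atLeast_Suc_greaterThan)
next
  case (Suc i)
  \<comment> \<open>The condition \<open>n < n'\<close> is coded into the summand so that both
    variables range over fixed sets, as the exchange lemma requires.\<close>
  let ?f = "\<lambda>n n'. if n < n' then esum i x n / (real n - x) * (connected_sum x j n' / (real n' - x)) else 0"
  show ?case
  proof (rule nonneg_has_sum_swap[of "{1..}" "{1..}" ?f
        "\<lambda>n. esum i x n / (real n - x) * connected_sum x (Suc j) n"])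
    show "((\<lambda>n. esum i x n / (real n - x) * connected_sum x (Suc j) n) has_sum
         connected_sum x (Suc (Suc i + j)) 0) {1..}"
      using Suc.IH[of "Suc j"] by simp
  next
    fix n :: nat assume n: "n \<in> {1..}"
    have "((\<lambda>n'. esum i x n / (real n - x) * (connected_sum x j n' / (real n' - x))) has_sum
       esum i x n / (real n - x) * connected_sum x (Suc j) n) {n<..}"
      by (intro has_sum_cmult_right connected_sum_transport x)
    also have "?this \<longleftrightarrow> (?f n has_sum esum i x n / (real n - x) * connected_sum x (Suc j) n) {1..}"
      using n by (intro has_sum_cong_neutral) auto
    finally show "(?f n has_sum esum i x n / (real n - x) * connected_sum x (Suc j) n) {1..}" .
  next
    fix n' :: nat assume n': "n' \<in> {1..}"
    show "((\<lambda>n. ?f n n') has_sum esum (Suc i) x n' / (real n' - x) * connected_sum x j n') {1..}"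
      by (rule has_sum_finite_neutralI[where B = "{1..<n'}"])
         (auto simp: sum_distrib_right sum_divide_distrib intro!: sum.cong)
  next
    fix n n' :: nat assume "n \<in> {1..}" "n' \<in> {1..}"
    then show "0 \<le> ?f n n'"
      using x esum_nonneg[OF x(2), of i n] connected_sum_nonneg[OF x(2), of j n'] by auto
  qed
qed

text \<open>The two ends of the transport chain: exponent 0 contributes the factor
  \<open>1 / n\<close>, and at the bound 0 the connector is 1.\<close>

lemma sum_formula_generating:
  assumes x: "0 < x" "x < 1"
  obtains F where "((\<lambda>n. esum j x n / (real n * (real n - x))) has_sum F) {1..}"
    and "((\<lambda>m. 1 / (real m ^ Suc j * (real m - x))) has_sum F) {1..}"
proof
  have "((\<lambda>n. esum j x n / (real n - x) * connected_sum x 0 n) has_sum connected_sum x (Suc j) 0) {1..}"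
    using esum_connected_has_sum[OF x, of j 0] by simp
  also have "?this \<longleftrightarrow> ((\<lambda>n. esum j x n / (real n * (real n - x))) has_sum connected_sum x (Suc j) 0) {1..}"
    using x by (intro has_sum_cong) (simp add: connected_sum_0)
  finally show "((\<lambda>n. esum j x n / (real n * (real n - x))) has_sum connected_sum x (Suc j) 0) {1..}" .
  show "((\<lambda>m. 1 / (real m ^ Suc j * (real m - x))) has_sum connected_sum x (Suc j) 0) {1..}"
    using connected_sum_has_sum[OF x, of "Suc j" 0] x by (simp add: connector_0)
qed

section \<open>Differentiation of the sum formula in the parameter\<close>

fun esum_deriv :: "nat \<Rightarrow> real \<Rightarrow> nat \<Rightarrow> real" where
  "esum_deriv 0 x N = 0"
| "esum_deriv (Suc j) x N =
     (\<Sum>m\<in>{1..<N}. esum_deriv j x m / (real m - x) + esum j x m / (real m - x)\<^sup>2)"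

lemma has_field_derivative_divide_shifted:
  fixes f :: "real \<Rightarrow> real"
  assumes "(f has_field_derivative D) (at x)" "c \<noteq> x"
  shows "((\<lambda>y. f y / (c - y)) has_field_derivative D / (c - x) + f x / (c - x)\<^sup>2) (at x)"
proof -
  have "((\<lambda>y. f y / (c - y)) has_field_derivative
      (D * (c - x) - f x * (0 - 1)) / ((c - x) * (c - x))) (at x)"
    using assms by (intro DERIV_divide DERIV_diff DERIV_const DERIV_ident) auto
  also have "(D * (c - x) - f x * (0 - 1)) / ((c - x) * (c - x)) = D / (c - x) + f x / (c - x)\<^sup>2"
    using assms(2) by (simp add: add_divide_distrib power2_eq_square)
  finally show ?thesis .
qed

lemma has_field_derivative_esum:
  assumes "x < 1"
  shows "((\<lambda>x. esum j x N) has_field_derivative esum_deriv j x N) (at x)"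
proof (induction j arbitrary: N)
  case (Suc j)
  have "((\<lambda>x. esum j x m / (real m - x)) has_field_derivative
      esum_deriv j x m / (real m - x) + esum j x m / (real m - x)\<^sup>2) (at x)" if "m \<in> {1..<N}" for m
    using that assms by (intro has_field_derivative_divide_shifted Suc.IH) auto
  then show ?case by (auto intro!: DERIV_sum)
qed auto

lemma nonneg_powser_esum: "nonneg_powser (\<lambda>x. esum j x N)"
proof (induction j arbitrary: N)
  case (Suc j)
  have "nonneg_powser (\<lambda>x. \<Sum>m\<in>{1..<N}. esum j x m * (1 / (real m - x)))"
    by (intro nonneg_powser_sum nonneg_powser_mult nonneg_powser_shifted_inverse Suc.IH) auto
  then show ?case by simp
qed (simp add: nonneg_powser_const)

text \<open>Both series of the sum formula consist of functions with nonnegative Taylor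
  coefficients, so both may be differentiated termwise. The derivatives agree because the sums agree
  as functions of the parameter.\<close>

lemma sum_formula_generating_deriv:
  assumes x: "0 < x" "x < 1"
  obtains F where
    "((\<lambda>n. esum_deriv j x n / (real n * (real n - x)) + esum j x n / (real n * (real n - x)\<^sup>2)) has_sum F) {1..}"
    and "((\<lambda>m. 1 / (real m ^ Suc j * (real m - x)\<^sup>2)) has_sum F) {1..}"
proof -
  \<comment> \<open>The sum formula yields a value for each point separately; these are collected
    into one function so that \<open>deriv F\<close> is meaningful.\<close>
  define F where "F = (\<lambda>x. \<Sum>\<^sub>\<infinity>m\<in>{1::nat..}. 1 / (real m ^ Suc j * (real m - x)))"
  have F: "((\<lambda>n. esum j y n / (real n * (real n - y))) has_sum F y) {1..}"
    "((\<lambda>m. 1 / (real m ^ Suc j * (real m - y))) has_sum F y) {1..}" if "0 < y" "y < 1" for y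
  proof -
    obtain G where G: "((\<lambda>n. esum j y n / (real n * (real n - y))) has_sum G) {1..}"
      "((\<lambda>m. 1 / (real m ^ Suc j * (real m - y))) has_sum G) {1..}"
      using sum_formula_generating[OF \<open>0 < y\<close> \<open>y < 1\<close>] .
    moreover have "F y = G" unfolding F_def by (rule infsumI[OF G(2)])
    ultimately show "((\<lambda>n. esum j y n / (real n * (real n - y))) has_sum F y) {1..}"
      "((\<lambda>m. 1 / (real m ^ Suc j * (real m - y))) has_sum F y) {1..}" by simp_all
  qed
  show ?thesis
  proof (rule that)
    have "((\<lambda>n. deriv (\<lambda>y. esum j y n / (real n * (real n - y))) x) has_sum deriv F x) {1..}"
    proof (rule has_sum_deriv_nonneg_powser[OF _ F(1) x])
      fix n :: nat assume "n \<in> {1..}"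
      then have "nonneg_powser (\<lambda>y. esum j y n * (1 / real n) * (1 / (real n - y)))"
        by (intro nonneg_powser_mult nonneg_powser_shifted_inverse nonneg_powser_esum nonneg_powser_const) auto
      then show "nonneg_powser (\<lambda>y. esum j y n / (real n * (real n - y)))" by simp
    qed
    also have "?this \<longleftrightarrow> ((\<lambda>n. esum_deriv j x n / (real n * (real n - x)) + esum j x n / (real n * (real n - x)\<^sup>2)) has_sum deriv F x) {1..}"
    proof (intro has_sum_cong DERIV_imp_deriv)
      fix n :: nat assume "n \<in> {1..}"
      then have "((\<lambda>y. esum j y n / real n / (real n - y)) has_field_derivative
        esum_deriv j x n / real n / (real n - x) + esum j x n / real n / (real n - x)\<^sup>2) (at x)"
        using x by (intro has_field_derivative_divide_shifted DERIV_cdivide has_field_derivative_esum) auto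
      then show "((\<lambda>y. esum j y n / (real n * (real n - y))) has_field_derivative
        esum_deriv j x n / (real n * (real n - x)) + esum j x n / (real n * (real n - x)\<^sup>2)) (at x)"
        by simp
    qed
    finally show "((\<lambda>n. esum_deriv j x n / (real n * (real n - x)) + esum j x n / (real n * (real n - x)\<^sup>2)) has_sum deriv F x) {1..}" .
    have "((\<lambda>m. deriv (\<lambda>y. 1 / (real m ^ Suc j * (real m - y))) x) has_sum deriv F x) {1..}"
    proof (rule has_sum_deriv_nonneg_powser[OF _ F(2) x])
      fix n :: nat assume "n \<in> {1..}"
      then have "nonneg_powser (\<lambda>y. (1 / real n ^ Suc j) * (1 / (real n - y)))"
        by (intro nonneg_powser_mult nonneg_powser_shifted_inverse nonneg_powser_const) auto
      then show "nonneg_powser (\<lambda>y. 1 / (real n ^ Suc j * (real n - y)))" by simp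
    qed
    also have "?this \<longleftrightarrow> ((\<lambda>m. 1 / (real m ^ Suc j * (real m - x)\<^sup>2)) has_sum deriv F x) {1..}"
    proof (intro has_sum_cong DERIV_imp_deriv)
      fix n :: nat assume "n \<in> {1..}"
      then have "((\<lambda>y. 1 / real n ^ Suc j / (real n - y)) has_field_derivative
        0 / (real n - x) + 1 / real n ^ Suc j / (real n - x)\<^sup>2) (at x)"
        using x by (intro has_field_derivative_divide_shifted DERIV_const) auto
      then show "((\<lambda>y. 1 / (real n ^ Suc j * (real n - y))) has_field_derivative
        1 / (real n ^ Suc j * (real n - x)\<^sup>2)) (at x)"
        by simp
    qed
    finally show "((\<lambda>m. 1 / (real m ^ Suc j * (real m - x)\<^sup>2)) has_sum deriv F x) {1..}" .
  qed
qed

section \<open>The weighted sum\<close>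

lemma esum_Suc_Suc:
  "1 \<le> N \<Longrightarrow> esum (Suc j) x (Suc N) = esum (Suc j) x N + esum j x N / (real N - x)"
  by (simp add: sum.atLeastLessThan_Suc)

text \<open>In the product the extra variable either avoids the \<open>j\<close> given ones, and
  then each set of \<open>j + 1\<close> variables arises \<open>j + 1\<close> times, or it equals
  one of them and squares its factor. The latter terms make up the derivative. The induction on
  \<open>N\<close> splits off the largest admissible value.\<close>

lemma esum_1_mult_esum:
  "esum 1 x N * esum j x N = real (j + 1) * esum (j + 1) x N + esum_deriv j x N"
proof (induction N arbitrary: j)
  case 0
  show ?case by (cases j) auto
next
  case (Suc N)
  show ?case
  proof (cases "j = 0 \<or> N = 0")
    case True
    then show ?thesis by (cases j) auto
  next
    case False
    then obtain i where j: "j = Suc i" and N: "1 \<le> N" by (cases j) auto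
    define u where "u = 1 / (real N - x)"
    have e1: "esum 1 x (Suc N) = esum 1 x N + u"
      using esum_Suc_Suc[OF N, of 0 x] by (simp add: u_def)
    have ej: "esum (Suc l) x (Suc N) = esum (Suc l) x N + esum l x N * u" for l
      using esum_Suc_Suc[OF N, of l x] by (simp add: u_def)
    have dj: "esum_deriv (Suc i) x (Suc N) = esum_deriv (Suc i) x N + esum_deriv i x N * u + esum i x N * u * u"
      using N by (simp add: sum.atLeastLessThan_Suc u_def power2_eq_square)
    have IH1: "esum 1 x N * esum (Suc i) x N = real (i + 2) * esum (Suc (Suc i)) x N + esum_deriv (Suc i) x N"
      using Suc.IH[of "Suc i"] by simp
    have IH2: "esum 1 x N * esum i x N = real (i + 1) * esum (Suc i) x N + esum_deriv i x N"
      using Suc.IH[of i] by simp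
    have "esum 1 x (Suc N) * esum (Suc i) x (Suc N) =
        esum 1 x N * esum (Suc i) x N + (esum 1 x N * esum i x N) * u
          + u * esum (Suc i) x N + esum i x N * u * u"
      unfolding e1 ej by (simp only: algebra_simps)
    also have "\<dots> = real (i + 2) * (esum (Suc (Suc i)) x N + esum (Suc i) x N * u)
          + (esum_deriv (Suc i) x N + esum_deriv i x N * u + esum i x N * u * u)"
      unfolding IH1 IH2 by (simp only: of_nat_add of_nat_1 of_nat_numeral algebra_simps)
    also have "\<dots> = real (i + 2) * esum (Suc (Suc i)) x (Suc N) + esum_deriv (Suc i) x (Suc N)"
      unfolding dj ej[of "Suc i"] ..
    finally show ?thesis unfolding j by (simp del: shifted_sum.simps esum_deriv.simps replicate.simps)
  qed
qed

lemma diff_one_divide: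
  fixes u v :: "'a::field"
  assumes "u \<noteq> 0" "v \<noteq> 0"
  shows "1 / u - 1 / v = (v - u) / (v * u)"
  using assms by (simp add: field_simps)

text \<open>Here \<open>K = k - 2\<close>. The \<open>j\<close>-th summand doubles the shift of the
  first \<open>j\<close> of the \<open>k - 1\<close> variables below the largest, matching the
  weight 2^(s_2 + ... + s_(j+1) - j). The separate last summand repeats the case
  \<open>j = K\<close>, as the extra power of 2 in \<open>coef\<close> does.\<close>

definition weighted_tail :: "nat \<Rightarrow> real \<Rightarrow> nat \<Rightarrow> real" where
  "weighted_tail K x N =
     (\<Sum>j\<le>K. shifted_sum (replicate j (2 * x) @ replicate (K + 1 - j) x) N)
       + shifted_sum (replicate K (2 * x) @ [x]) N"

text \<open>The coefficient of t^N in the product of the series over a of t^a / (a - x) and the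
  series over b of e_K(b) t^b / (b - x).\<close>

definition shuffle_sum :: "nat \<Rightarrow> real \<Rightarrow> nat \<Rightarrow> real" where
  "shuffle_sum K x N = (\<Sum>b\<in>{1..<N}. esum K x b / ((real (N - b) - x) * (real b - x)))"

lemma weighted_tail_0: "weighted_tail 0 x N = 2 * esum 1 x N"
  by (simp add: weighted_tail_def)

text \<open>Only the list for \<open>j = 0\<close> starts with \<open>x\<close>, and it gives the
  \<open>esum\<close>. All others start with \<open>2 * x\<close>, and removing that entry leaves
  the lists for \<open>K\<close>.\<close>

lemma weighted_tail_Suc:
  "weighted_tail (Suc K) x N = esum (K + 2) x N + (\<Sum>m\<in>{1..<N}. weighted_tail K x m / (real m - 2 * x))"
proof -
  have "weighted_tail (Suc K) x N = esum (K + 2) x N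
     + (\<Sum>j\<le>K. \<Sum>m\<in>{1..<N}. shifted_sum (replicate j (2 * x) @ replicate (K + 1 - j) x) m / (real m - 2 * x))
     + (\<Sum>m\<in>{1..<N}. shifted_sum (replicate K (2 * x) @ [x]) m / (real m - 2 * x))"
    unfolding weighted_tail_def sum.atMost_Suc_shift by (simp del: sum.atMost_Suc)
  then show ?thesis
    by (subst (asm) sum.swap)
       (simp add: weighted_tail_def sum.distrib add_divide_distrib sum_divide_distrib add.assoc
         del: shifted_sum.simps replicate.simps)
qed

text \<open>The multiplier is the sum of the two denominators:
  \<open>N - 2 * x = (N - b - x) + (b - x)\<close>.\<close>

lemma shuffle_sum_partial_fractions:
  assumes "0 < x" "x < 1"
  shows "(real N - 2 * x) * shuffle_sum K x N =
    esum (Suc K) x N + (\<Sum>b\<in>{1..<N}. esum K x b / (real (N - b) - x))"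
proof -
  have "(real N - 2 * x) * (esum K x b / ((real (N - b) - x) * (real b - x))) =
      esum K x b / (real b - x) + esum K x b / (real (N - b) - x)" if "b \<in> {1..<N}" for b
  proof -
    have nz: "real (N - b) - x \<noteq> 0" "real b - x \<noteq> 0" using that assms by auto
    have "(u + v) * (e / (u * v)) = e / v + e / u" if "u \<noteq> 0" "v \<noteq> 0" for e u v :: real
      using that by (simp add: field_simps)
    note this[OF nz, of "esum K x b"]
    moreover have "(real (N - b) - x) + (real b - x) = real N - 2 * x" using that by (simp add: of_nat_diff)
    ultimately show ?thesis by simp
  qed
  then have "(real N - 2 * x) * shuffle_sum K x N =
      (\<Sum>b\<in>{1..<N}. esum K x b / (real b - x) + esum K x b / (real (N - b) - x))"
    unfolding shuffle_sum_def sum_distrib_left by (intro sum.cong) auto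
  then show ?thesis by (simp add: sum.distrib)
qed

lemma sum_shuffle_sum:
  "(\<Sum>b\<in>{1..<N}. esum (Suc K) x b / (real (N - b) - x)) = (\<Sum>m\<in>{1..<N}. shuffle_sum K x m)"
proof -
  have "(\<Sum>b\<in>{1..<N}. esum (Suc K) x b / (real (N - b) - x)) =
     (\<Sum>b\<in>{1..<N}. \<Sum>c\<in>{1..<b}. esum K x c / ((real (N - b) - x) * (real c - x)))"
    by (simp add: sum_divide_distrib mult.commute)
  also have "\<dots> = (\<Sum>(b, c)\<in>Sigma {1..<N} (\<lambda>b. {1..<b}). esum K x c / ((real (N - b) - x) * (real c - x)))"
    by (rule sum.Sigma) auto
  \<comment> \<open>The substitution \<open>m = N - b + c\<close> preserves the difference
    \<open>N - b = m - c\<close>, hence the summand.\<close>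
  also have "\<dots> = (\<Sum>(m, c)\<in>Sigma {1..<N} (\<lambda>m. {1..<m}). esum K x c / ((real (m - c) - x) * (real c - x)))"
    by (rule sum.reindex_bij_witness[of _ "\<lambda>(m, c). (N - (m - c), c)" "\<lambda>(b, c). (N - b + c, c)"]) auto
  also have "\<dots> = (\<Sum>m\<in>{1..<N}. shuffle_sum K x m)"
    unfolding shuffle_sum_def by (rule sum.Sigma[symmetric]) auto
  finally show ?thesis .
qed

text \<open>This is the shuffle product of a single and a multiple polylogarithm, read off at the
  coefficient of the N-th power of the argument; the doubled shifts come from the product rule.\<close>

lemma weighted_tail_eq_shuffle_sum:
  assumes "0 < x" "x < 1/2"
  shows "weighted_tail K x N = (real N - 2 * x) * shuffle_sum K x N"
proof (induction K arbitrary: N)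
  case 0
  have "(\<Sum>b\<in>{1..<N}. 1 / (real (N - b) - x)) = (\<Sum>b\<in>{1..<N}. 1 / (real b - x))"
    by (rule sum.reindex_bij_witness[of _ "\<lambda>b. N - b" "\<lambda>b. N - b"]) auto
  then show ?case
    using assms by (simp add: shuffle_sum_partial_fractions weighted_tail_0)
next
  case (Suc K)
  have "weighted_tail K x m / (real m - 2 * x) = shuffle_sum K x m" if "m \<in> {1..<N}" for m
  proof -
    have "real m - 2 * x \<noteq> 0" using that assms by auto
    then show ?thesis by (simp add: Suc.IH)
  qed
  then have "weighted_tail (Suc K) x N = esum (K + 2) x N + (\<Sum>m\<in>{1..<N}. shuffle_sum K x m)"
    by (simp add: weighted_tail_Suc)
  also have "\<dots> = (real N - 2 * x) * shuffle_sum (Suc K) x N"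
    using assms
    by (subst shuffle_sum_partial_fractions) (simp_all only: sum_shuffle_sum, auto)
  finally show ?case .
qed

text \<open>Up to the factor \<open>1 / b\<close> the summand is a difference of reciprocals at
  distance \<open>b\<close>; summation over \<open>N\<close> leaves the first \<open>b\<close> of
  them.\<close>

lemma has_sum_partial_fractions:
  assumes "0 < x" "x < 1" "1 \<le> b"
  shows "((\<lambda>N. 1 / ((real N - x) * (real (N - b) - x))) has_sum esum 1 x (Suc b) / real b) {b<..}"
proof -
  \<comment> \<open>\<open>G a\<close> is a window of \<open>b\<close> consecutive reciprocals, so a
    difference at distance \<open>b\<close> becomes a difference of neighbouring windows.\<close>
  define G where "G = (\<lambda>a. \<Sum>i\<in>{1..b}. 1 / (real (a + i) - x))"
  have diff: "G a - G (Suc a) = 1 / (real (Suc a) - x) - 1 / (real (Suc a + b) - x)" for a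
  proof -
    have "G a - G (Suc a) = (\<Sum>i\<in>{1..b}. 1 / (real (a + i) - x) - 1 / (real (a + Suc i) - x))"
      by (simp add: G_def sum_subtractf add_ac)
    also have "\<dots> = 1 / (real (a + 1) - x) - 1 / (real (a + Suc b) - x)"
      by (induction b) auto
    finally show ?thesis by (simp add: add_ac)
  qed
  have lim: "(\<lambda>n. 1 / (real (n + i) - x)) \<longlonglongrightarrow> 0" for i
  proof -
    have "filterlim (\<lambda>n. (real i - x) + real n) at_top sequentially"
      by (intro filterlim_tendsto_add_at_top[OF tendsto_const] filterlim_real_sequentially)
    then have "filterlim (\<lambda>n. real (n + i) - x) at_infinity sequentially"
      by (intro filterlim_at_top_imp_at_infinity) (simp add: algebra_simps)
    then show ?thesis by (intro tendsto_divide_0[OF tendsto_const])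
  qed
  have "G \<longlonglongrightarrow> (\<Sum>i\<in>{1..b}. 0)"
    unfolding G_def by (intro tendsto_sum lim)
  then have "G \<longlonglongrightarrow> 0" by simp
  from sums_divide[OF telescope_sums'[OF this], of "real b"]
  have s: "(\<lambda>a. (G a - G (Suc a)) / real b) sums (G 0 / real b)" by simp
  have eq: "(G a - G (Suc a)) / real b = 1 / ((real (Suc a + b) - x) * (real (Suc a) - x))" for a
  proof -
    have nz: "real (Suc a) - x \<noteq> 0" "real (Suc a + b) - x \<noteq> 0" using assms by auto
    have "(real (Suc a + b) - x) - (real (Suc a) - x) = real b" by simp
    then show ?thesis using assms(3) by (simp only: diff diff_one_divide[OF nz]) simp
  qed
  have "((\<lambda>a. 1 / ((real (Suc a + b) - x) * (real (Suc a) - x))) has_sum (G 0 / real b)) UNIV"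
    using s unfolding eq by (rule sums_nonneg_imp_has_sum) (use assms in auto)
  also have "?this \<longleftrightarrow> ((\<lambda>N. 1 / ((real N - x) * (real (N - b) - x))) has_sum G 0 / real b) {b<..}"
    by (rule has_sum_reindex_bij_witness[of _ "\<lambda>N. N - Suc b" "\<lambda>a. Suc a + b"]) auto
  also have "G 0 = esum 1 x (Suc b)"
    by (simp add: G_def atLeastLessThanSuc_atLeastAtMost)
  finally show ?thesis .
qed

text \<open>Two evaluations of one double sum over \<open>b < N\<close>. For fixed \<open>b\<close>,
  partial fractions apply. For fixed \<open>N\<close>, the shuffle sum appears, since the difference
  of the two fractions is \<open>x / ((N - x) * (N - 2 * x))\<close> and its factor
  \<open>N - 2 * x\<close> cancels.\<close>

lemma weighted_tail_has_sum:
  assumes x: "0 < x" "x < 1/2"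
    and T: "((\<lambda>b. x * esum K x b * esum 1 x (Suc b) / (real b * (real b - x))) has_sum T) {1..}"
  shows "((\<lambda>N. (1 / (real N - 2 * x) - 1 / (real N - x)) * weighted_tail K x N) has_sum T) {1..}"
proof -
  let ?f = "\<lambda>b N. if b < N then x * esum K x b / (real b - x) * (1 / ((real N - x) * (real (N - b) - x))) else 0"
  show ?thesis
  proof (rule nonneg_has_sum_swap[where f = ?f, OF _ _ T])
    have x1: "x < 1" using x by simp
    show "0 \<le> ?f b N" if "b \<in> {1..}" "N \<in> {1..}" for b N :: nat
      using that x esum_nonneg[OF x1, of K b] by auto
    show "(?f b has_sum x * esum K x b * esum 1 x (Suc b) / (real b * (real b - x))) {1..}" if b: "b \<in> {1..}" for b
    proof -
      have "((\<lambda>N. x * esum K x b / (real b - x) * (1 / ((real N - x) * (real (N - b) - x)))) has_sum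
          x * esum K x b / (real b - x) * (esum 1 x (Suc b) / real b)) {b<..}"
        using b x by (intro has_sum_cmult_right has_sum_partial_fractions) auto
      also have "?this \<longleftrightarrow> (?f b has_sum x * esum K x b / (real b - x) * (esum 1 x (Suc b) / real b)) {1..}"
        by (intro has_sum_cong_neutral) auto
      also have "x * esum K x b / (real b - x) * (esum 1 x (Suc b) / real b) =
          x * esum K x b * esum 1 x (Suc b) / (real b * (real b - x))"
        by (simp only: times_divide_times_eq mult.commute)
      finally show ?thesis .
    qed
    show "((\<lambda>b. ?f b N) has_sum (1 / (real N - 2 * x) - 1 / (real N - x)) * weighted_tail K x N) {1..}" if N: "N \<in> {1..}" for N
    proof (rule has_sum_finite_neutralI[where B = "{1..<N}"])
      have nz: "real N - 2 * x \<noteq> 0" "real N - x \<noteq> 0" using N x by auto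
      have d: "1 / (real N - 2 * x) - 1 / (real N - x) = x / ((real N - x) * (real N - 2 * x))"
        unfolding diff_one_divide[OF nz] by simp
      have "(1 / (real N - 2 * x) - 1 / (real N - x)) * weighted_tail K x N = x / (real N - x) * shuffle_sum K x N"
        unfolding d weighted_tail_eq_shuffle_sum[OF x] using nz by simp
      also have "\<dots> = (\<Sum>b\<in>{1..<N}. ?f b N)"
        unfolding shuffle_sum_def sum_distrib_left by (intro sum.cong) (auto simp: mult_ac)
      finally show "(1 / (real N - 2 * x) - 1 / (real N - x)) * weighted_tail K x N = (\<Sum>b\<in>{1..<N}. ?f b N)" .
    qed auto
  qed
qed

lemma weighted_sum_generating:
  assumes x: "0 < x" "x < 1/2"
  obtains L where
    "((\<lambda>N. x / (real N * (real N - x)) * esum (Suc K) x N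
        + (1 / (real N - 2 * x) - 1 / (real N - x)) * weighted_tail K x N) has_sum L) {1..}"
    and "((\<lambda>m. real (K + 2) * x / (real m ^ (K + 2) * (real m - x))
        + x / (real m ^ (K + 1) * (real m - x)\<^sup>2)) has_sum L) {1..}"
proof -
  have x1: "0 < x" "x < 1" using x by auto
  obtain F where F: "((\<lambda>n. esum (Suc K) x n / (real n * (real n - x))) has_sum F) {1..}"
    "((\<lambda>m. 1 / (real m ^ Suc (Suc K) * (real m - x))) has_sum F) {1..}"
    using sum_formula_generating[OF x1] .
  obtain D where D:
    "((\<lambda>n. esum_deriv K x n / (real n * (real n - x)) + esum K x n / (real n * (real n - x)\<^sup>2)) has_sum D) {1..}"
    "((\<lambda>m. 1 / (real m ^ Suc K * (real m - x)\<^sup>2)) has_sum D) {1..}"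
    using sum_formula_generating_deriv[OF x1] .
  \<comment> \<open>From e_1(b+1) = e_1(b) + 1 / (b - x), the product with e_K(b) is (K+1) e_(K+1)
    plus the derivative of e_K plus e_K / (b - x). The first term leads to \<open>F\<close>, and the
    other two together to \<open>D\<close>.\<close>
  define T where "T = x * (real (K + 1) * F + D)"
  have "((\<lambda>n. x * (real (K + 1) * (esum (Suc K) x n / (real n * (real n - x))) +
      (esum_deriv K x n / (real n * (real n - x)) + esum K x n / (real n * (real n - x)\<^sup>2)))) has_sum T) {1..}"
    unfolding T_def by (intro has_sum_cmult_right has_sum_add F D)
  also have "?this \<longleftrightarrow> ((\<lambda>b. x * esum K x b * esum 1 x (Suc b) / (real b * (real b - x))) has_sum T) {1..}"
  proof (rule has_sum_cong)
    fix b :: nat assume b: "b \<in> {1..}"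
    define u where "u = 1 / (real b - x)"
    have "esum 1 x (Suc b) = esum 1 x b + u"
      using esum_Suc_Suc[of b 0 x] b by (simp add: u_def)
    then have "esum K x b * esum 1 x (Suc b) = real (K + 1) * esum (Suc K) x b + esum_deriv K x b + esum K x b * u"
      using esum_1_mult_esum[of x b K] by (simp only: distrib_left Suc_eq_plus1 mult.commute[of "esum 1 x b"])
    then have "x * esum K x b * esum 1 x (Suc b) / (real b * (real b - x)) =
       x * (real (K + 1) * esum (Suc K) x b + esum_deriv K x b + esum K x b * u) / (real b * (real b - x))"
      by (simp only: mult.assoc)
    also have "\<dots> = x * (real (K + 1) * (esum (Suc K) x b / (real b * (real b - x))) +
      (esum_deriv K x b / (real b * (real b - x)) + esum K x b / (real b * (real b - x)\<^sup>2)))"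
      by (simp add: u_def add_divide_distrib distrib_left power2_eq_square mult_ac
            del: shifted_sum.simps replicate.simps)
    finally show "x * (real (K + 1) * (esum (Suc K) x b / (real b * (real b - x))) +
      (esum_deriv K x b / (real b * (real b - x)) + esum K x b / (real b * (real b - x)\<^sup>2))) =
      x * esum K x b * esum 1 x (Suc b) / (real b * (real b - x))" ..
  qed
  finally have T: "((\<lambda>N. (1 / (real N - 2 * x) - 1 / (real N - x)) * weighted_tail K x N) has_sum T) {1..}"
    by (rule weighted_tail_has_sum[OF x])
  show ?thesis
  proof (rule that)
    have "((\<lambda>N. x * (esum (Suc K) x N / (real N * (real N - x)))
        + (1 / (real N - 2 * x) - 1 / (real N - x)) * weighted_tail K x N) has_sum (x * F + T)) {1..}"
      by (intro has_sum_add has_sum_cmult_right F T)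
    then show "((\<lambda>N. x / (real N * (real N - x)) * esum (Suc K) x N
        + (1 / (real N - 2 * x) - 1 / (real N - x)) * weighted_tail K x N) has_sum (x * F + T)) {1..}"
      by (simp del: shifted_sum.simps replicate.simps)
    \<comment> \<open>The unweighted sum contributes one more \<open>x * F\<close>, which raises the
      factor \<open>K + 1\<close> in \<open>T\<close> to the depth \<open>K + 2\<close>.\<close>
    have "((\<lambda>m. real (K + 2) * x * (1 / (real m ^ Suc (Suc K) * (real m - x))) + x * (1 / (real m ^ Suc K * (real m - x)\<^sup>2)))
        has_sum (real (K + 2) * x * F + x * D)) {1..}"
      by (intro has_sum_add has_sum_cmult_right F D)
    moreover have "real (K + 2) * x * F + x * D = x * F + T"
      by (simp add: T_def algebra_simps)
    ultimately show "((\<lambda>m. real (K + 2) * x / (real m ^ (K + 2) * (real m - x))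
        + x / (real m ^ (K + 1) * (real m - x)\<^sup>2)) has_sum (x * F + T)) {1..}"
      by simp
  qed
qed

section \<open>Multiple zeta values and generating functions\<close>

fun truncated_mzv :: "nat list \<Rightarrow> nat \<Rightarrow> real" where
  "truncated_mzv [] N = 1"
| "truncated_mzv (a # s) N = (\<Sum>m\<in>{1..<N}. truncated_mzv s m / real m ^ a)"

lemma truncated_mzv_nonneg: "0 \<le> truncated_mzv s N"
  by (induction s arbitrary: N) (auto intro!: sum_nonneg)

definition decreasing_lists :: "nat \<Rightarrow> nat \<Rightarrow> nat list set" where
  "decreasing_lists l N = {ns. length ns = l \<and> sorted_wrt (>) ns \<and> (\<forall>m\<in>set ns. 1 \<le> m \<and> m < N)}"

text \<open>The set \<open>A\<close> of values of the largest variable is left open so that one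
  argument serves both truncated and complete sums.\<close>

lemma has_sum_mzv_term_Cons:
  assumes A: "A \<subseteq> {1..}"
    and s: "\<And>m. m \<in> A \<Longrightarrow> ((\<lambda>ns. \<Prod>i<length s. 1 / real (ns ! i) ^ (s ! i)) has_sum
              truncated_mzv s m) (decreasing_lists (length s) m)"
    and v: "((\<lambda>m. truncated_mzv s m / real m ^ a) has_sum v) A"
  shows "((\<lambda>ns. \<Prod>i<length (a # s). 1 / real (ns ! i) ^ ((a # s) ! i)) has_sum v)
           {m # ns |m ns. m \<in> A \<and> ns \<in> decreasing_lists (length s) m}"
proof -
  have "((\<lambda>(m, ns). 1 / real m ^ a * (\<Prod>i<length s. 1 / real (ns ! i) ^ (s ! i))) has_sum v)
      (Sigma A (decreasing_lists (length s)))"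
  proof (rule nonneg_has_sum_SigmaI[OF _ _ v])
    fix m assume "m \<in> A"
    from has_sum_cmult_right[OF s[OF this], of "1 / real m ^ a"]
    show "((\<lambda>ns. 1 / real m ^ a * (\<Prod>i<length s. 1 / real (ns ! i) ^ (s ! i))) has_sum
        truncated_mzv s m / real m ^ a) (decreasing_lists (length s) m)" by simp
  qed (intro mult_nonneg_nonneg prod_nonneg, auto)
  also have "?this \<longleftrightarrow> ?thesis"
    by (rule has_sum_reindex_bij_witness[of _ "\<lambda>ns. (hd ns, tl ns)" "\<lambda>(m, ns). m # ns"])
       (auto simp: prod.lessThan_Suc_shift simp del: prod.lessThan_Suc)
  finally show ?thesis .
qed

lemma has_sum_truncated_mzv:
  "((\<lambda>ns. \<Prod>i<length s. 1 / real (ns ! i) ^ (s ! i)) has_sum truncated_mzv s N)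
     (decreasing_lists (length s) N)"
proof (induction s arbitrary: N)
  case Nil
  have "decreasing_lists 0 N = {[]}" by (auto simp: decreasing_lists_def)
  then show ?case by (simp add: has_sum_finite_iff)
next
  case (Cons a s)
  have eq: "decreasing_lists (length (a # s)) N =
      {m # ns |m ns. m \<in> {1..<N} \<and> ns \<in> decreasing_lists (length s) m}"
    by (fastforce simp: decreasing_lists_def length_Suc_conv intro: less_trans)
  show ?case
    unfolding eq by (rule has_sum_mzv_term_Cons[OF _ Cons.IH]) (auto simp: has_sum_finite_iff)
qed

text \<open>As an \<open>infsum\<close>, \<open>mzv\<close> would default to 0 on a divergent
  family, so convergence enters as an assumption; it is supplied later by exchanging
  summations.\<close>

lemma mzv_Cons_eqI:
  assumes "((\<lambda>m. truncated_mzv s m / real m ^ a) has_sum v) {1..}"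
  shows "mzv (a # s) = v"
proof -
  have eq: "{ns. length ns = length (a # s) \<and> sorted_wrt (>) ns \<and> (\<forall>m\<in>set ns. m \<ge> 1)} =
      {m # ns |m ns. m \<in> {1..} \<and> ns \<in> decreasing_lists (length s) m}"
    by (auto simp: decreasing_lists_def length_Suc_conv)
  show ?thesis
    unfolding mzv_def eq
    by (rule infsumI[OF has_sum_mzv_term_Cons[OF subset_refl has_sum_truncated_mzv assms]])
qed

section \<open>Generating functions over exponent lists\<close>

definition positive_lists :: "nat \<Rightarrow> nat list set" where
  "positive_lists l = {s. length s = l \<and> (\<forall>a\<in>set s. 1 \<le> a)}"

text \<open>The monomial marking each exponent by its own parameter. The powers are lowered by one
  so that summing \<open>y ^ (a - 1) / m ^ a\<close> over \<open>a \<ge> 1\<close> gives exactly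
  \<open>1 / (m - y)\<close>.\<close>

definition list_weight :: "real list \<Rightarrow> nat list \<Rightarrow> real" where
  "list_weight ys s = prod_list (map2 (\<lambda>y a. y ^ (a - 1)) ys s)"

lemma list_weight_simps [simp]:
  "list_weight [] s = 1"
  "list_weight (y # ys) (a # s) = y ^ (a - 1) * list_weight ys s"
  by (simp_all add: list_weight_def)

lemma list_weight_nonneg: "(\<And>y. y \<in> set ys \<Longrightarrow> 0 \<le> y) \<Longrightarrow> 0 \<le> list_weight ys s"
  unfolding list_weight_def by (rule prod_list_nonneg) (auto dest: set_zip_leftD)

lemma has_sum_positive_lists_Suc:
  "((\<lambda>(a, s). f (a # s)) has_sum v) ({1..} \<times> positive_lists l) \<longleftrightarrow> (f has_sum v) (positive_lists (Suc l))"
  by (rule has_sum_reindex_bij_witness[of _ "\<lambda>s. (hd s, tl s)" "\<lambda>(a, s). a # s"])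
     (auto simp: positive_lists_def length_Suc_conv)

lemma has_sum_list_weight_truncated_mzv:
  assumes "\<And>y. y \<in> set ys \<Longrightarrow> 0 \<le> y \<and> y < 1"
  shows "((\<lambda>s. list_weight ys s * truncated_mzv s N) has_sum shifted_sum ys N) (positive_lists (length ys))"
  using assms
proof (induction ys arbitrary: N)
  case Nil
  have "positive_lists 0 = {[]}" by (auto simp: positive_lists_def)
  then show ?case by (simp add: has_sum_finite_iff)
next
  case (Cons y ys)
  have y: "0 \<le> y" "y < 1" using Cons.prems by auto
  have w: "0 \<le> list_weight ys s" for s using Cons.prems by (intro list_weight_nonneg) auto
  have "((\<lambda>(a, s). y ^ (a - 1) / real m ^ a * (list_weight ys s * truncated_mzv s m)) has_sum
      1 / (real m - y) * shifted_sum ys m) ({1..} \<times> positive_lists (length ys))" if "m \<in> {1..<N}" for m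
  proof -
    have "1 \<le> real m" using that by simp
    then have "y < real m" using y by linarith
    then show ?thesis
      using y w Cons.prems truncated_mzv_nonneg
      by (intro has_sum_nonneg_mult_product has_sum_geometric_shifted Cons.IH) auto
  qed
  then have "((\<lambda>q. \<Sum>m\<in>{1..<N}. (case q of (a, s) \<Rightarrow> y ^ (a - 1) / real m ^ a * (list_weight ys s * truncated_mzv s m))) has_sum
      (\<Sum>m\<in>{1..<N}. 1 / (real m - y) * shifted_sum ys m)) ({1..} \<times> positive_lists (length ys))"
    by (intro has_sum_sum_fun) auto
  then have "((\<lambda>(a, s). list_weight (y # ys) (a # s) * truncated_mzv (a # s) N) has_sum shifted_sum (y # ys) N)
      ({1..} \<times> positive_lists (length ys))"
    by (simp add: case_prod_unfold sum_distrib_left mult_ac)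
  then show ?case
    unfolding list.size(4) add_Suc_right add_0_right by (subst (asm) has_sum_positive_lists_Suc)
qed

lemma sum_list_ge_length: "s \<in> positive_lists l \<Longrightarrow> l \<le> sum_list s"
proof (induction s arbitrary: l)
  case (Cons a s)
  then have "length s \<le> sum_list s" "1 \<le> a" by (auto simp: positive_lists_def)
  then show ?case using Cons.prems by (simp add: positive_lists_def)
qed (simp add: positive_lists_def)

text \<open>All entries are at least 1, so the natural-number subtractions are exact. The powers of
  2 come from the first \<open>j\<close> entries only, while those of \<open>x\<close> depend only
  on the total.\<close>

lemma list_weight_replicate:
  assumes "t \<in> positive_lists l" "j \<le> l"
  shows "list_weight (replicate j (2 * x) @ replicate (l - j) x) t =
           2 ^ (sum_list (take j t) - j) * x ^ (sum_list t - l)"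
  using assms
proof (induction t arbitrary: j l)
  case (Cons a t)
  obtain l' where l: "l = Suc l'" "t \<in> positive_lists l'" "1 \<le> a"
    using Cons.prems by (auto simp: positive_lists_def)
  have tl: "l' \<le> sum_list t" by (rule sum_list_ge_length[OF l(2)])
  have x: "x ^ (a + sum_list t - Suc l') = x ^ (a - 1) * x ^ (sum_list t - l')"
    using tl l(3) by (simp flip: power_add)
  show ?case
  proof (cases j)
    case 0
    then show ?thesis using Cons.IH[OF l(2), of 0] x by (simp add: l)
  next
    case (Suc i)
    have "take i t \<in> positive_lists i"
      using l Cons.prems Suc by (auto simp: positive_lists_def dest: in_set_takeD)
    then have "i \<le> sum_list (take i t)" by (rule sum_list_ge_length)
    then have "(2::real) ^ (a + sum_list (take i t) - Suc i) = 2 ^ (a - 1) * 2 ^ (sum_list (take i t) - i)"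
      using l(3) by (simp flip: power_add)
    then show ?thesis
      using Cons.IH[OF l(2), of i] Cons.prems x by (simp add: Suc l power_mult_distrib mult_ac)
  qed
qed (simp add: positive_lists_def)

text \<open>The index \<open>i\<close> of \<open>coef\<close> becomes \<open>j = i - 1\<close>, and
  writing \<open>2 ^ (a - 1)\<close> as \<open>1 + (2 ^ (a - 1) - 1)\<close> supplies the summand
  \<open>j = 0\<close>. The power of \<open>x\<close> records the excess of the weight over the
  depth \<open>K + 2\<close>.\<close>

lemma coef_Cons:
  assumes t: "t \<in> positive_lists (K + 1)" and a: "1 \<le> a"
  shows "coef (a # t) * x ^ (a + sum_list t - (K + 2)) =
    x ^ (a - 1) * list_weight (replicate (K + 1) x) t +
    ((2 * x) ^ (a - 1) - x ^ (a - 1)) *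
      ((\<Sum>j\<le>K. list_weight (replicate j (2 * x) @ replicate (K + 1 - j) x) t)
        + list_weight (replicate K (2 * x) @ [x]) t)"
proof -
  define X where "X = x ^ (sum_list t - (K + 1))"
  define q where "q = (\<lambda>j. (2::real) ^ (sum_list (take j t) - j))"
  have len: "length t = K + 1" using t by (simp add: positive_lists_def)
  have w: "list_weight (replicate j (2 * x) @ replicate (K + 1 - j) x) t = q j * X" if "j \<le> K" for j
    using list_weight_replicate[OF t, of j x] that by (simp add: X_def q_def)
  have w0: "list_weight (replicate (K + 1) x) t = X"
    using w[of 0] by (simp add: q_def)
  have wK: "list_weight (replicate K (2 * x) @ [x]) t = q K * X"
    using w[of K] by simp
  have "coef (a # t) = 2 ^ (a - 1) + (2 ^ (a - 1) - 1) * ((\<Sum>i=2..K+1. q (i - 1)) + q K)"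
  proof -
    have "psum (a # t) i - a - (i - 1) = sum_list (take (i - 1) t) - (i - 1)" if "1 \<le> i" for i
      using that by (cases i) (auto simp: psum_def)
    from this this[of "K + 1"] show ?thesis
      unfolding coef_def Let_def q_def list.size(4) len by (simp del: One_nat_def)
  qed
  also have "(\<Sum>i=2..K+1. q (i - 1)) = (\<Sum>j=1..K. q j)"
    by (rule sum.reindex_bij_witness[of _ Suc "\<lambda>i. i - 1"]) auto
  also have "\<dots> = (\<Sum>j\<le>K. q j) - 1"
  proof -
    have "(\<Sum>j\<le>K. q j) = q 0 + (\<Sum>j=1..K. q j)"
      unfolding atMost_atLeast0 by (subst sum.atLeast_Suc_atMost) auto
    then show ?thesis by (simp add: q_def)
  qed
  finally have c: "coef (a # t) = 1 + (2 ^ (a - 1) - 1) * ((\<Sum>j\<le>K. q j) + q K)"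
    by (simp add: algebra_simps)
  have e: "x ^ (a + sum_list t - (K + 2)) = x ^ (a - 1) * X"
    using sum_list_ge_length[OF t] a by (simp add: X_def flip: power_add)
  have "(\<Sum>j\<le>K. list_weight (replicate j (2 * x) @ replicate (K + 1 - j) x) t) = (\<Sum>j\<le>K. q j) * X"
    unfolding sum_distrib_right by (intro sum.cong w) auto
  then show ?thesis
    unfolding c e w0 wK power_mult_distrib by (simp add: algebra_simps)
qed

text \<open>Positivity serves twice: it permits exchanging summations, and it allows division by the
  coefficient when convergence of a zeta value is extracted.\<close>

lemma coef_ge_1: "1 \<le> coef s"
proof -
  have "0 \<le> (2 ^ (s ! 0 - 1) - (1::real)) * B" if "0 \<le> B" for B
    using that by (intro mult_nonneg_nonneg) auto
  moreover have "1 \<le> (2::real) ^ (s ! 0 - 1)" by simp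
  ultimately show ?thesis unfolding coef_def Let_def
    by (smt (verit) sum_nonneg zero_le_power)
qed

lemma has_sum_weighted_truncated_mzv:
  assumes x: "0 < x" "x < 1/2" and N: "1 \<le> N"
  shows "((\<lambda>(a, t). coef (a # t) * x ^ (a + sum_list t - (K + 2)) * (truncated_mzv t N / real N ^ a)) has_sum
     x / (real N * (real N - x)) * esum (Suc K) x N
        + (1 / (real N - 2 * x) - 1 / (real N - x)) * weighted_tail K x N) ({2..} \<times> positive_lists (K + 1))"
proof -
  have lt: "x < real N" "2 * x < real N" using x N by auto
  have A: "((\<lambda>a. x ^ (a - 1) / real N ^ a) has_sum x / (real N * (real N - x))) {2..}"
    using x lt by (intro has_sum_geometric_shifted_from_2) auto
  have "((\<lambda>a. (2 * x) ^ (a - 1) / real N ^ a + - (x ^ (a - 1) / real N ^ a)) has_sum 1 / (real N - 2 * x) + - (1 / (real N - x))) {1..}"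
    using x lt by (intro has_sum_add has_sum_uminusI has_sum_geometric_shifted) auto
  \<comment> \<open>At \<open>a = 1\<close> the two powers agree, so the sum from 1 equals the sum
    from 2 required for the first exponent.\<close>
  also have "?this \<longleftrightarrow> ((\<lambda>a. ((2 * x) ^ (a - 1) - x ^ (a - 1)) / real N ^ a) has_sum 1 / (real N - 2 * x) - 1 / (real N - x)) {2..}"
    unfolding add_uminus_conv_diff
    by (rule has_sum_cong_neutral) (auto simp: diff_divide_distrib not_le numeral_2_eq_2 less_Suc_eq)
  finally have B: "((\<lambda>a. ((2 * x) ^ (a - 1) - x ^ (a - 1)) / real N ^ a) has_sum 1 / (real N - 2 * x) - 1 / (real N - x)) {2..}" .
  have E: "((\<lambda>t. list_weight ys t * truncated_mzv t N) has_sum shifted_sum ys N) (positive_lists (K + 1))"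
    if "length ys = K + 1" "set ys \<subseteq> {x, 2 * x}" for ys
    unfolding \<open>length ys = K + 1\<close>[symmetric]
    by (rule has_sum_list_weight_truncated_mzv) (use that x in auto)
  have C: "((\<lambda>t. (\<Sum>j\<le>K. list_weight (replicate j (2 * x) @ replicate (K + 1 - j) x) t * truncated_mzv t N)
        + list_weight (replicate K (2 * x) @ [x]) t * truncated_mzv t N) has_sum weighted_tail K x N) (positive_lists (K + 1))"
    unfolding weighted_tail_def by (intro has_sum_add has_sum_sum_fun E) auto
  have w: "0 \<le> list_weight ys t" if "set ys \<subseteq> {x, 2 * x}" for ys t
    using that x by (intro list_weight_nonneg) auto
  have nn: "0 \<le> ((2 * x) ^ (a - 1) - x ^ (a - 1)) / real N ^ a" for a
    using x by (auto intro!: divide_nonneg_nonneg power_mono)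
  have "((\<lambda>(a, t). x ^ (a - 1) / real N ^ a * (list_weight (replicate (Suc K) x) t * truncated_mzv t N)) has_sum
      x / (real N * (real N - x)) * esum (Suc K) x N) ({2..} \<times> positive_lists (K + 1))"
    using x by (intro has_sum_nonneg_mult_product A E mult_nonneg_nonneg w truncated_mzv_nonneg) auto
  moreover have "((\<lambda>(a, t). ((2 * x) ^ (a - 1) - x ^ (a - 1)) / real N ^ a *
      ((\<Sum>j\<le>K. list_weight (replicate j (2 * x) @ replicate (K + 1 - j) x) t * truncated_mzv t N)
        + list_weight (replicate K (2 * x) @ [x]) t * truncated_mzv t N)) has_sum
      (1 / (real N - 2 * x) - 1 / (real N - x)) * weighted_tail K x N) ({2..} \<times> positive_lists (K + 1))"
    by (intro has_sum_nonneg_mult_product B C nn add_nonneg_nonneg sum_nonneg mult_nonneg_nonneg w truncated_mzv_nonneg) auto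
  ultimately have "((\<lambda>q. (case q of (a, t) \<Rightarrow> x ^ (a - 1) / real N ^ a * (list_weight (replicate (Suc K) x) t * truncated_mzv t N))
     + (case q of (a, t) \<Rightarrow> ((2 * x) ^ (a - 1) - x ^ (a - 1)) / real N ^ a *
      ((\<Sum>j\<le>K. list_weight (replicate j (2 * x) @ replicate (K + 1 - j) x) t * truncated_mzv t N)
        + list_weight (replicate K (2 * x) @ [x]) t * truncated_mzv t N))) has_sum
     x / (real N * (real N - x)) * esum (Suc K) x N
        + (1 / (real N - 2 * x) - 1 / (real N - x)) * weighted_tail K x N) ({2..} \<times> positive_lists (K + 1))"
    by (rule has_sum_add)
  also have "?this \<longleftrightarrow> ?thesis"
  proof (rule has_sum_cong)
    fix q assume q: "q \<in> {2::nat..} \<times> positive_lists (K + 1)"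
    obtain a t where at: "q = (a, t)" by (cases q)
    have t: "t \<in> positive_lists (K + 1)" and "1 \<le> a" using q at by auto
    show "(case q of (a, t) \<Rightarrow> x ^ (a - 1) / real N ^ a * (list_weight (replicate (Suc K) x) t * truncated_mzv t N))
     + (case q of (a, t) \<Rightarrow> ((2 * x) ^ (a - 1) - x ^ (a - 1)) / real N ^ a *
      ((\<Sum>j\<le>K. list_weight (replicate j (2 * x) @ replicate (K + 1 - j) x) t * truncated_mzv t N)
        + list_weight (replicate K (2 * x) @ [x]) t * truncated_mzv t N)) =
      (case q of (a, t) \<Rightarrow> coef (a # t) * x ^ (a + sum_list t - (K + 2)) * (truncated_mzv t N / real N ^ a))"
      unfolding at prod.case coef_Cons[OF t \<open>1 \<le> a\<close>] Suc_eq_plus1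
      by (simp only: sum_distrib_right[symmetric] distrib_right[symmetric] times_divide_eq_left
          times_divide_eq_right add_divide_distrib[symmetric] mult.assoc)
         (simp only: distrib_right mult.assoc)
  qed
  finally show ?thesis .
qed

section \<open>Grouping by weight and comparison of coefficients\<close>

definition admissible :: "nat \<Rightarrow> nat \<Rightarrow> nat list set" where
  "admissible k n = {s. length s = k \<and> (\<forall>x\<in>set s. x \<ge> 1) \<and> s ! 0 \<ge> 2 \<and> sum_list s = n}"

lemma finite_admissible: "finite (admissible k n)"
proof (rule finite_subset)
  show "admissible k n \<subseteq> {s. set s \<subseteq> {..n} \<and> length s = k}"
    by (auto simp: admissible_def dest: member_le_sum_list)
qed (intro finite_lists_length_eq finite_atMost)

text \<open>Exchanging summations moves the largest variable \<open>N\<close> to the inside, where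
  its sum is a zeta value. The remaining sum over exponent lists is grouped by the excess
  \<open>p\<close> of weight over depth, each group being finite.\<close>

lemma weighted_sum_powser:
  assumes x: "0 < x" "x < 1/2"
    and L: "((\<lambda>N. x / (real N * (real N - x)) * esum (Suc K) x N
        + (1 / (real N - 2 * x) - 1 / (real N - x)) * weighted_tail K x N) has_sum L) {1..}"
  shows "((\<lambda>p. (\<Sum>s\<in>admissible (K + 2) (K + 2 + p). coef s * mzv s) * x ^ p) has_sum L) {1..}"
proof -
  let ?f = "\<lambda>N (a, t). coef (a # t) * x ^ (a + sum_list t - (K + 2)) * (truncated_mzv t N / real N ^ a)"
  let ?B = "{2::nat..} \<times> positive_lists (K + 1)"
  have nn: "0 \<le> ?f N q" for N q
    using x coef_ge_1[of "fst q # snd q"] truncated_mzv_nonneg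
    by (auto simp: case_prod_unfold)
  have mzv: "(\<Sum>\<^sub>\<infinity>N\<in>{1..}. ?f N q) = (case q of (a, t) \<Rightarrow> coef (a # t) * x ^ (a + sum_list t - (K + 2)) * mzv (a # t))"
    if q: "q \<in> ?B" for q
  proof -
    obtain a t where [simp]: "q = (a, t)" by (cases q)
    have "(\<lambda>N. ?f N q) summable_on {1..}"
      by (rule nonneg_has_sum_swap_ex(1)[OF _ _ L q])
         (use nn has_sum_weighted_truncated_mzv[OF x] in auto)
    moreover have "coef (a # t) * x ^ (a + sum_list t - (K + 2)) \<noteq> 0"
      using coef_ge_1[of "a # t"] x by auto
    ultimately have "(\<lambda>N. truncated_mzv t N / real N ^ a) summable_on {1..}"
      unfolding \<open>q = (a, t)\<close> case_prod_conv by (subst (asm) summable_on_cmult_right')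
    then have "((\<lambda>N. truncated_mzv t N / real N ^ a) has_sum mzv (a # t)) {1..}"
      using mzv_Cons_eqI[OF has_sum_infsum] by simp
    from has_sum_cmult_right[OF this] show ?thesis
      by (simp only: case_prod_conv \<open>q = (a, t)\<close>) (rule infsumI)
  qed
  have "((\<lambda>q. \<Sum>\<^sub>\<infinity>N\<in>{1..}. ?f N q) has_sum L) ?B"
    by (rule nonneg_has_sum_swap_ex(2)[OF _ _ L])
       (use nn has_sum_weighted_truncated_mzv[OF x] in auto)
  also have "?this \<longleftrightarrow> ((\<lambda>(a, t). coef (a # t) * x ^ (a + sum_list t - (K + 2)) * mzv (a # t)) has_sum L) ?B"
    by (intro has_sum_cong mzv)
  \<comment> \<open>The excess \<open>p\<close> is at least 1 because \<open>a \<ge> 2\<close> and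
    the other \<open>K + 1\<close> exponents are at least 1.\<close>
  also have "\<dots> \<longleftrightarrow> ((\<lambda>(p, s). coef s * mzv s * x ^ p) has_sum L) (Sigma {1..} (\<lambda>p. admissible (K + 2) (K + 2 + p)))"
  proof (rule has_sum_reindex_bij_witness[of _ "\<lambda>(p, s). (hd s, tl s)" "\<lambda>(a, t). (a + sum_list t - (K + 2), a # t)"])
    fix q assume q: "q \<in> ?B"
    obtain a t where [simp]: "q = (a, t)" by (cases q)
    have "K + 1 \<le> sum_list t" using q sum_list_ge_length[of t "K + 1"] by simp
    then show "(case q of (a, t) \<Rightarrow> (a + sum_list t - (K + 2), a # t)) \<in> Sigma {1..} (\<lambda>p. admissible (K + 2) (K + 2 + p))"
      using q by (auto simp: admissible_def positive_lists_def)
  next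
    fix q assume q: "q \<in> Sigma {1..} (\<lambda>p. admissible (K + 2) (K + 2 + p))"
    obtain p s where ps [simp]: "q = (p, s)" by (cases q)
    obtain a t where s [simp]: "s = a # t" using q by (cases s) (auto simp: admissible_def)
    show "(case case q of (p, s) \<Rightarrow> (hd s, tl s) of (a, t) \<Rightarrow> (a + sum_list t - (K + 2), a # t)) = q"
      using q by (auto simp: admissible_def)
    show "(case q of (p, s) \<Rightarrow> (hd s, tl s)) \<in> ?B"
      using q by (auto simp: admissible_def positive_lists_def)
  qed (auto simp: mult_ac)
  finally show ?thesis
    by (rule has_sum_SigmaD) (auto simp: has_sum_finite_iff finite_admissible sum_distrib_right)
qed

text \<open>The factor \<open>k + p\<close> is split: \<open>k\<close> leads to a geometric series
  in \<open>x / m\<close>, and \<open>p\<close> to its derivative.\<close>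

lemma has_sum_zeta_term:
  assumes x: "0 < x" "x < 1" and m: "1 \<le> m"
  shows "((\<lambda>p. real (k + p) / real m ^ (k + p) * x ^ p) has_sum
     real k * x / (real m ^ k * (real m - x)) + x * real m / (real m ^ k * (real m - x)\<^sup>2)) {1..}"
proof -
  define r where "r = x / real m"
  have m0: "real m > 0" "real m - x > 0" using x m by auto
  have r: "0 < r" "r < 1" using x m by (auto simp: r_def)
  have "(\<lambda>n. real (Suc n) * r ^ n * r) sums (1 / (1 - r)\<^sup>2 * r)"
    using r by (intro sums_mult2 geometric_deriv_sums) auto
  then have "((\<lambda>n. real (Suc n) * r ^ n * r) has_sum (1 / (1 - r)\<^sup>2 * r)) UNIV"
    using r by (intro sums_nonneg_imp_has_sum) auto
  then have d: "((\<lambda>p. real p * r ^ p) has_sum (1 / (1 - r)\<^sup>2 * r)) {1..}"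
    by (subst has_sum_from_1_iff) (simp add: mult_ac)
  have "(\<lambda>n. r ^ n * r) sums (1 / (1 - r) * r)"
    using r by (intro sums_mult2 geometric_sums) auto
  then have "((\<lambda>n. r ^ n * r) has_sum (1 / (1 - r) * r)) UNIV"
    using r by (intro sums_nonneg_imp_has_sum) auto
  then have g: "((\<lambda>p. r ^ p) has_sum (1 / (1 - r) * r)) {1..}"
    by (subst has_sum_from_1_iff) (simp add: mult_ac)
  have "((\<lambda>p. real k / real m ^ k * r ^ p + 1 / real m ^ k * (real p * r ^ p)) has_sum
     (real k / real m ^ k * (1 / (1 - r) * r) + 1 / real m ^ k * (1 / (1 - r)\<^sup>2 * r))) {1..}"
    by (intro has_sum_add has_sum_cmult_right d g)
  moreover have "real k / real m ^ k * r ^ p + 1 / real m ^ k * (real p * r ^ p) = real (k + p) / real m ^ (k + p) * x ^ p" for p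
    using m0 by (simp add: r_def power_divide power_add field_simps)
  moreover have "1 / (1 - r) * r = x / (real m - x)"
    using m0 by (simp add: r_def field_simps)
  moreover have "1 / (1 - r)\<^sup>2 * r = x * real m / (real m - x)\<^sup>2"
  proof -
    have "1 - r = (real m - x) / real m" using m0 by (simp add: r_def field_simps)
    then show ?thesis using m0 by (simp add: r_def power2_eq_square)
  qed
  ultimately show ?thesis by (simp only: times_divide_times_eq mult_1)
qed

lemma zeta_powser:
  assumes x: "0 < x" "x < 1"
    and L: "((\<lambda>m. real (K + 2) * x / (real m ^ (K + 2) * (real m - x))
        + x / (real m ^ (K + 1) * (real m - x)\<^sup>2)) has_sum L) {1..}"
  shows "((\<lambda>p. real (K + 2 + p) * mzv [K + 2 + p] * x ^ p) has_sum L) {1..}"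
proof -
  let ?f = "\<lambda>m p. real (K + 2 + p) / real m ^ (K + 2 + p) * x ^ p"
  have f: "(?f m has_sum real (K + 2) * x / (real m ^ (K + 2) * (real m - x))
        + x / (real m ^ (K + 1) * (real m - x)\<^sup>2)) {1..}" if "m \<in> {1..}" for m
  proof -
    have "1 \<le> m" using that by simp
    have eq: "x * real m / (real m ^ (K + 2) * (real m - x)\<^sup>2) = x / (real m ^ (K + 1) * (real m - x)\<^sup>2)"
      using that by simp
    show ?thesis using has_sum_zeta_term[OF x \<open>1 \<le> m\<close>, of "K + 2"] by (simp only: eq)
  qed
  have mzv: "(\<Sum>\<^sub>\<infinity>m\<in>{1..}. ?f m p) = real (K + 2 + p) * mzv [K + 2 + p] * x ^ p" if "p \<in> {1..}" for p
  proof -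
    have eq: "(\<lambda>m. ?f m p) = (\<lambda>m. real (K + 2 + p) * x ^ p * (truncated_mzv [] m / real m ^ (K + 2 + p)))"
      by (simp add: fun_eq_iff)
    have "(\<lambda>m. ?f m p) summable_on {1..}"
      by (rule nonneg_has_sum_swap_ex(1)[OF _ f L that]) (use x in auto)
    then have "(\<lambda>m. truncated_mzv [] m / real m ^ (K + 2 + p)) summable_on {1..}"
      unfolding eq using x by (subst (asm) summable_on_cmult_right') auto
    then have "((\<lambda>m. truncated_mzv [] m / real m ^ (K + 2 + p)) has_sum mzv [K + 2 + p]) {1..}"
      using mzv_Cons_eqI[OF has_sum_infsum] by simp
    from infsumI[OF has_sum_cmult_right[OF this, of "real (K + 2 + p) * x ^ p"]] show ?thesis
      unfolding eq by (simp only: mult_ac)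
  qed
  have "((\<lambda>p. \<Sum>\<^sub>\<infinity>m\<in>{1..}. ?f m p) has_sum L) {1..}"
    by (rule nonneg_has_sum_swap_ex(2)[OF _ f L]) (use x in auto)
  also have "?this \<longleftrightarrow> ?thesis" by (intro has_sum_cong mzv)
  finally show ?thesis .
qed

theorem theorem1p1:
  fixes k n :: nat
  assumes "k \<ge> 2" and "n \<ge> k + 1"
  shows "(\<Sum>s\<in>{s. length s = k \<and> (\<forall>x\<in>set s. x \<ge> 1) \<and> s ! 0 \<ge> 2 \<and> sum_list s = n}.
            coef s * mzv s) = real n * mzv [n]"
proof -
  obtain K where k: "k = K + 2" using assms(1) by (metis add.commute le_Suc_ex)
  define p where "p = n - k"
  have n: "n = K + 2 + p" and "1 \<le> p" using assms k by (auto simp: p_def)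
  \<comment> \<open>The common value \<open>L\<close> is obtained for each \<open>x\<close>
    separately; \<open>F\<close> turns these values into one function, as the comparison of
    coefficients requires.\<close>
  define F where "F = (\<lambda>x. \<Sum>\<^sub>\<infinity>p\<in>{1..}. real (K + 2 + p) * mzv [K + 2 + p] * x ^ p)"
  have F: "((\<lambda>p. (\<Sum>s\<in>admissible (K + 2) (K + 2 + p). coef s * mzv s) * x ^ p) has_sum F x) {1..}"
    "((\<lambda>p. real (K + 2 + p) * mzv [K + 2 + p] * x ^ p) has_sum F x) {1..}"
    if x: "0 < x" "x < 1/2" for x
  proof -
    obtain L where L:
      "((\<lambda>N. x / (real N * (real N - x)) * esum (Suc K) x N
          + (1 / (real N - 2 * x) - 1 / (real N - x)) * weighted_tail K x N) has_sum L) {1..}"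
      "((\<lambda>m. real (K + 2) * x / (real m ^ (K + 2) * (real m - x))
          + x / (real m ^ (K + 1) * (real m - x)\<^sup>2)) has_sum L) {1..}"
      using weighted_sum_generating[OF x] .
    have "x < 1" using x by simp
    have z: "((\<lambda>p. real (K + 2 + p) * mzv [K + 2 + p] * x ^ p) has_sum L) {1..}"
      by (rule zeta_powser[OF \<open>0 < x\<close> \<open>x < 1\<close> L(2)])
    then have "F x = L" unfolding F_def by (rule infsumI)
    then show "((\<lambda>p. (\<Sum>s\<in>admissible (K + 2) (K + 2 + p). coef s * mzv s) * x ^ p) has_sum F x) {1..}"
      "((\<lambda>p. real (K + 2 + p) * mzv [K + 2 + p] * x ^ p) has_sum F x) {1..}"
      using weighted_sum_powser[OF x L(1)] z by simp_all
  qed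
  \<comment> \<open>The radius \<open>1/2\<close> keeps the doubled shift \<open>2 * x\<close> below
    every summation variable.\<close>
  have "(\<Sum>s\<in>admissible (K + 2) (K + 2 + p). coef s * mzv s) = real (K + 2 + p) * mzv [K + 2 + p]"
    by (rule powser_coeff_unique[where r = "1/2", OF _ F \<open>1 \<le> p\<close>]) auto
  then show ?thesis by (simp only: admissible_def k n)
qed

end
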